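(* Let $\mathbf{B}_p \in H(\mathrm{curl}, \mathcal{T}_{2D})_m$ be defined by $$\langle \mathbf{\Sigma}, r \mathbf{B}_p \rangle + \langle \nabla^\perp \cdot \mathbf{\Sigma}, \Psi \rangle - \int_{\partial \mathcal{T}_{2D}} \Psi\, (\mathbf{\Sigma} \cdot \mathbf{n}^\perp) \, dS = 0 \qquad \forall\, \mathbf{\Sigma} \in H(\mathrm{curl}, \mathcal{T}_{2D})_m .$$ Further, assume the boundary of the 2D planar domain to be piecewise linear. Then $\mathbf{B}_p$ admits as discrete (weak) divergence $D_b \in CG(\mathcal{T}_{2D})_m$, defined by $$\langle \eta, r D_b \rangle = -\langle r \nabla \eta, \mathbf{B}_p \rangle + \int_{\partial \mathcal{T}_{2D}} r\, \eta\, g_1 \, dS \qquad \forall\, \eta \in CG(\mathcal{T}_{2D})_m, \qquad g_1 := -\tfrac{1}{r}\, \mathbf{n} \cdot \nabla^\perp \Psi,$$ such that $D_b \equiv 0$.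
   Context: Coordinates and operators: the 2D planar domain lies in the $(r,z)$-plane (the poloidal plane of cylindrical coordinates $(r,\phi,z)$), and $(r,z)$ are treated as Cartesian coordinates. For a scalar $\psi$ and a vector field $\mathbf{A} = (A_r, A_z)$, set $\nabla \psi = (\partial_r \psi, \partial_z \psi)^T$, $\mathbf{A}^\perp = (-A_z, A_r)$, $\nabla^\perp \psi = (-\partial_z \psi, \partial_r \psi)^T$, and $\nabla^\perp \cdot \mathbf{A} = -\partial_z A_r + \partial_r A_z$. The factor $r$ is the coordinate function (the Jacobian factor of cylindrical coordinates, written explicitly). $\mathcal{T}_{2D}$ is a mesh (triangles or quadrilaterals) of the domain. $\langle \cdot, \cdot \rangle$ is the $L^2$ inner product in Cartesian $(r,z)$-space over the meshed domain, for scalar or vector fields; $\partial \mathcal{T}_{2D}$ is the boundary of that domain, $\mathbf{n}$ its outward unit normal, $\mathbf{n}^\perp$ the rotated normal, and $dS$ the boundary measure. Finite element spaces, with $m$ the polynomial degree: $CG(\mathcal{T}_{2D})_m$ is the continuous Galerkin space of degree $m$. $H(\mathrm{curl}, \mathcal{T}_{2D})_m$ is the curl-conforming (tangentially continuous) Raviart–Thomas edge space ($RT^e_m$ on triangles, $RTc^e_m$ on quadrilaterals, with $m=1$ the lowest order). $DG(\mathcal{T}_{2D})_{m-1}$ is the matching discontinuous Galerkin space. They form a discrete de Rham complex: $\nabla$ maps $CG(\mathcal{T}_{2D})_m$ into $H(\mathrm{curl}, \mathcal{T}_{2D})_m$, and $\nabla^\perp \cdot$ maps $H(\mathrm{curl},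 \mathcal{T}_{2D})_m$ into $DG(\mathcal{T}_{2D})_{m-1}$, with $\nabla^\perp \cdot \nabla \eta = 0$. $\Psi$ is the given scalar poloidal flux function. The defining equation of $\mathbf{B}_p$ is introduced for $\Psi$ a discontinuous Galerkin field, and is also used when $\Psi$ is a continuous Galerkin field (the pairing with $\nabla^\perp\cdot\mathbf{\Sigma}$ then implicitly projects $\Psi$ into the DG space); the result places no further restriction on the space of $\Psi$. Interpretation: $\mathbf{B}_p$ is the weak discretization (after integration by parts) of the poloidal magnetic field $\frac{1}{r}\nabla^\perp \Psi$, and $D_b$ is the weak discretization of its axisymmetric divergence $\frac{1}{r}\nabla\cdot(r\mathbf{B}_p)$; using the definition of $\mathbf{B}_p$, the term $g_1$ corresponds to $-\mathbf{n}\cdot\mathbf{B}_p$.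
   Formalization: The boundary term is subtracted, not added: with the displayed plus sign the claim is false. If Ψ jumps at boundary vertices, g_1 is the distributional tangential derivative with point masses there. Also r ≥ 0 and no boundary edge lies on the axis r = 0. *)

theory Defs
  imports "HOL-Analysis.Analysis"
begin

text \<open>Points \<open>(r, z)\<close> of the poloidal plane are pairs of reals: \<open>r = fst x\<close>, \<open>z = snd x\<close>.\<close>

type_synonym point = "real \<times> real"

definition perp :: "point \<Rightarrow> point"
  where "perp A = (- snd A, fst A)"

text \<open>The derivatives are taken within the closed cell \<open>S\<close>, so that at a point of the boundary of
  \<open>S\<close> they are the one-sided traces from \<open>S\<close>.\<close>

definition grad :: "point set \<Rightarrow> (point \<Rightarrow> real) \<Rightarrow> point \<Rightarrow> point"
  where "grad S f x =
    (let D = frechet_derivative f (at x within S) in (D (1, 0), D (0, 1)))"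

definition perp_grad :: "point set \<Rightarrow> (point \<Rightarrow> real) \<Rightarrow> point \<Rightarrow> point"
  where "perp_grad S f x = perp (grad S f x)"

definition perp_div :: "point set \<Rightarrow> (point \<Rightarrow> point) \<Rightarrow> point \<Rightarrow> real"
  where "perp_div S A x =
    (let D = frechet_derivative A (at x within S) in - fst (D (0, 1)) + snd (D (1, 0)))"


section \<open>Cells and meshes\<close>

text \<open>A cell is the list of its vertices in counterclockwise order: three for a triangle, four for a
  quadrilateral. Since \<open>perp u \<bullet> v\<close> is the determinant of \<open>u, v\<close>, the condition below asks for
  a strict left turn at each vertex; with at most four vertices this makes the polygon simple and
  strictly convex.\<close>

type_synonym cell = "point list"

definition edges :: "cell \<Rightarrow> (point \<times> point) set"
  where "edges K = {(K ! i, K ! (Suc i mod length K)) | i. i < length K}"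

definition is_cell :: "cell \<Rightarrow> bool"
  where "is_cell K \<longleftrightarrow> length K \<in> {3, 4} \<and>
    (\<forall>i < length K.
      perp (K ! (Suc i mod length K) - K ! i)
        \<bullet> (K ! (Suc (Suc i) mod length K) - K ! (Suc i mod length K)) > 0)"

definition ref_cell :: "cell \<Rightarrow> point set"
  where "ref_cell K =
    (if length K = 3 then {(s, t). 0 \<le> s \<and> 0 \<le> t \<and> s + t \<le> 1} else {0..1} \<times> {0..1})"

text \<open>The reference map is affine on triangles and bilinear on quadrilaterals; its image of the
  reference cell is the closed polygon with the given vertices.\<close>

fun cell_map :: "cell \<Rightarrow> point \<Rightarrow> point" where
  "cell_map [a, b, c] (s, t) = a + s *\<^sub>R (b - a) + t *\<^sub>R (c - a)"
| "cell_map [a, b, c, d] (s, t) =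
     ((1 - s) * (1 - t)) *\<^sub>R a + (s * (1 - t)) *\<^sub>R b + (s * t) *\<^sub>R c + ((1 - s) * t) *\<^sub>R d"
| "cell_map _ _ = 0"

definition region :: "cell \<Rightarrow> point set"
  where "region K = cell_map K ` ref_cell K"

definition mesh_domain :: "cell set \<Rightarrow> point set"
  where "mesh_domain T = (\<Union>K\<in>T. region K)"

text \<open>Conforming meshes: two distinct cells share nothing, a vertex, or a whole edge. As all cells
  are oriented counterclockwise, a shared edge is traversed in opposite directions.\<close>

definition is_mesh :: "cell set \<Rightarrow> bool"
  where "is_mesh T \<longleftrightarrow> finite T \<and> T \<noteq> {} \<and> (\<forall>K\<in>T. is_cell K) \<and>
    ((\<forall>K\<in>T. length K = 3) \<or> (\<forall>K\<in>T. length K = 4)) \<and>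
    (\<forall>K\<in>T. \<forall>K'\<in>T. K \<noteq> K' \<longrightarrow>
      region K \<inter> region K' = {} \<or>
      (\<exists>v \<in> set K \<inter> set K'. region K \<inter> region K' = {v}) \<or>
      (\<exists>a b. (a, b) \<in> edges K \<and> (b, a) \<in> edges K' \<and>
        region K \<inter> region K' = closed_segment a b))"

text \<open>The boundary of the meshed domain is the union of the edges that belong to one cell only. Each
  is recorded with its cell, and directed counterclockwise around that cell.\<close>

definition boundary_edges :: "cell set \<Rightarrow> (cell \<times> point \<times> point) set"
  where "boundary_edges T =
    {(K, a, b). K \<in> T \<and> (a, b) \<in> edges K \<and> \<not> (\<exists>K'\<in>T. (b, a) \<in> edges K')}"

definition outward_normal :: "point \<Rightarrow> point \<Rightarrow> point"
  where "outward_normal a b = - perp (b - a) /\<^sub>R norm (b - a)"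

definition piecewise_linear :: "point set \<Rightarrow> bool"
  where "piecewise_linear C \<longleftrightarrow>
    (\<exists>E. finite E \<and> C = (\<Union>(a, b)\<in>E. closed_segment a b))"


section \<open>Integrals over the mesh\<close>

text \<open>Fields that may jump between cells are families indexed by the cells. A boundary integrand may
  depend on the adjacent cell (for traces), on the normal and on the point.\<close>

definition mesh_integral :: "cell set \<Rightarrow> (cell \<Rightarrow> point \<Rightarrow> real) \<Rightarrow> real"
  where "mesh_integral T f = (\<Sum>K\<in>T. integral (region K) (f K))"

definition boundary_integral ::
    "cell set \<Rightarrow> (cell \<Rightarrow> point \<Rightarrow> point \<Rightarrow> real) \<Rightarrow> real"
  where "boundary_integral T f =
    (\<Sum>(K, a, b)\<in>boundary_edges T.
      norm (b - a) * integral {0..1} (\<lambda>t. f K (outward_normal a b) (a + t *\<^sub>R (b - a))))"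


section \<open>Finite element spaces\<close>

definition poly_span :: "(nat \<times> nat) set \<Rightarrow> (point \<Rightarrow> real) set"
  where "poly_span I = {p. \<exists>c. \<forall>s t. p (s, t) = (\<Sum>(i, j)\<in>I. c i j * s ^ i * t ^ j)}"

text \<open>\<open>P\<^sub>m\<close> on triangles, \<open>Q\<^sub>m\<close> on quadrilaterals.\<close>

definition ref_CG :: "cell \<Rightarrow> nat \<Rightarrow> (point \<Rightarrow> real) set"
  where "ref_CG K m =
    (if length K = 3 then poly_span {(i, j). i + j \<le> m} else poly_span ({..m} \<times> {..m}))"

text \<open>On triangles the rotated Raviart--Thomas space, that is, the full vector polynomials of degree
  \<open>m - 1\<close> plus the rotated position vector times the homogeneous polynomials of degree
  \<open>m - 1\<close>; on quadrilaterals \<open>Q\<close> with degrees \<open>(m - 1, m)\<close> times \<open>Q\<close> with degrees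
  \<open>(m, m - 1)\<close>. Here \<open>m \<ge> 1\<close>, and \<open>m = 1\<close> is the lowest order.\<close>

definition ref_Hcurl :: "cell \<Rightarrow> nat \<Rightarrow> (point \<Rightarrow> point) set"
  where "ref_Hcurl K m =
    (if length K = 3
     then {\<lambda>x. (p x, q x) + h x *\<^sub>R perp x | p q h.
             p \<in> poly_span {(i, j). i + j \<le> m - 1} \<and> q \<in> poly_span {(i, j). i + j \<le> m - 1} \<and>
             h \<in> poly_span {(i, j). i + j = m - 1}}
     else {\<lambda>x. (p x, q x) | p q.
             p \<in> poly_span ({..m - 1} \<times> {..m}) \<and> q \<in> poly_span ({..m} \<times> {..m - 1})})"

definition CG :: "cell set \<Rightarrow> nat \<Rightarrow> (point \<Rightarrow> real) set"
  where "CG T m = {f. continuous_on (mesh_domain T) f \<and>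
    (\<forall>K\<in>T. \<exists>p \<in> ref_CG K m. \<forall>x \<in> ref_cell K. f (cell_map K x) = p x)}"

text \<open>Writing \<open>F\<close> for the reference map, the first condition is the covariant Piola transform
  \<open>DF\<^sup>T (\<Sigma> \<circ> F) = A\<close> tested with an arbitrary vector \<open>h\<close>; the second is tangential continuity
  across the interior edges.\<close>

definition Hcurl :: "cell set \<Rightarrow> nat \<Rightarrow> (cell \<Rightarrow> point \<Rightarrow> point) set"
  where "Hcurl T m = {\<Sigma>.
    (\<forall>K\<in>T. \<exists>A \<in> ref_Hcurl K m. \<forall>x \<in> ref_cell K. \<forall>h.
      \<Sigma> K (cell_map K x) \<bullet> frechet_derivative (cell_map K) (at x) h = A x \<bullet> h) \<and>
    (\<forall>K\<in>T. \<forall>K'\<in>T. \<forall>a b. (a, b) \<in> edges K \<longrightarrow> (b, a) \<in> edges K' \<longrightarrow>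
      (\<forall>x \<in> closed_segment a b. \<Sigma> K x \<bullet> (b - a) = \<Sigma> K' x \<bullet> (b - a)))}"

text \<open>Scalar fields that are \<open>C\<^sup>1\<close> up to the boundary of each cell, with no continuity between
  cells. All discontinuous and continuous Galerkin fields, of any degree, are of this kind.\<close>

definition cellwise_C1 :: "cell set \<Rightarrow> (cell \<Rightarrow> point \<Rightarrow> real) \<Rightarrow> bool"
  where "cellwise_C1 T \<Psi> \<longleftrightarrow> (\<forall>K\<in>T. \<exists>G. continuous_on (region K) G \<and>
    (\<forall>x \<in> region K. (\<Psi> K has_derivative (\<lambda>h. G x \<bullet> h)) (at x within region K)))"

text \<open>The traces from adjacent cells agree, so that the family is one continuous field.\<close>

definition single_trace :: "cell set \<Rightarrow> (cell \<Rightarrow> point \<Rightarrow> real) \<Rightarrow> bool"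
  where "single_trace T \<Psi> \<longleftrightarrow> (\<exists>\<psi>. \<forall>K\<in>T. \<forall>x \<in> region K. \<Psi> K x = \<psi> x)"


section \<open>Poloidal field and weak divergence\<close>

definition is_poloidal_field ::
    "cell set \<Rightarrow> nat \<Rightarrow> (cell \<Rightarrow> point \<Rightarrow> real) \<Rightarrow> (cell \<Rightarrow> point \<Rightarrow> point) \<Rightarrow> bool"
  where "is_poloidal_field T m \<Psi> B \<longleftrightarrow> B \<in> Hcurl T m \<and>
    (\<forall>\<Sigma> \<in> Hcurl T m.
      mesh_integral T (\<lambda>K x. \<Sigma> K x \<bullet> (fst x *\<^sub>R B K x))
      + mesh_integral T (\<lambda>K x. perp_div (region K) (\<Sigma> K) x * \<Psi> K x)
      - boundary_integral T (\<lambda>K n x. \<Psi> K x * (\<Sigma> K x \<bullet> perp n)) = 0)"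

definition g1 :: "(cell \<Rightarrow> point \<Rightarrow> real) \<Rightarrow> cell \<Rightarrow> point \<Rightarrow> point \<Rightarrow> real"
  where "g1 \<Psi> K n x = - (1 / fst x) * (n \<bullet> perp_grad (region K) (\<Psi> K) x)"

definition g1_integral :: "cell set \<Rightarrow> (cell \<Rightarrow> point \<Rightarrow> real) \<Rightarrow> (point \<Rightarrow> real) \<Rightarrow> real"
  where "g1_integral T \<Psi> \<eta> = boundary_integral T (\<lambda>K n x. fst x * \<eta> x * g1 \<Psi> K n x)"

text \<open>Since \<open>r g\<^sub>1 = n\<^sup>\<bottom> \<bullet> \<nabla>\<Psi>\<close> is the derivative of \<open>\<Psi>\<close> along the boundary, taken
  counterclockwise around the adjacent cell, it contains for discontinuous \<open>\<Psi>\<close> a point mass at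
  each boundary vertex, of size the outgoing minus the incoming trace.\<close>

definition boundary_jump :: "cell set \<Rightarrow> (cell \<Rightarrow> point \<Rightarrow> real) \<Rightarrow> point \<Rightarrow> real"
  where "boundary_jump T \<Psi> v =
    (\<Sum>(K, a, b) \<in> {e \<in> boundary_edges T. fst (snd e) = v}. \<Psi> K v)
    - (\<Sum>(K, a, b) \<in> {e \<in> boundary_edges T. snd (snd e) = v}. \<Psi> K v)"

definition g1_pairing :: "cell set \<Rightarrow> (cell \<Rightarrow> point \<Rightarrow> real) \<Rightarrow> (point \<Rightarrow> real) \<Rightarrow> real"
  where "g1_pairing T \<Psi> \<eta> =
    g1_integral T \<Psi> \<eta> + (\<Sum>v \<in> (\<Union>K\<in>T. set K). \<eta> v * boundary_jump T \<Psi> v)"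

text \<open>The boundary functional \<open>\<beta>\<close> stands for the integral of \<open>r \<eta> g\<^sub>1\<close>. It is subtracted:
  integrating the divergence of \<open>r B\<close> by parts gives the boundary term \<open>r \<eta> (n \<bullet> B)\<close>, and
  \<open>g\<^sub>1\<close> corresponds to \<open>- n \<bullet> B\<close>.\<close>

definition is_weak_divergence ::
    "cell set \<Rightarrow> nat \<Rightarrow> (cell \<Rightarrow> point \<Rightarrow> point) \<Rightarrow> ((point \<Rightarrow> real) \<Rightarrow> real) \<Rightarrow>
     (point \<Rightarrow> real) \<Rightarrow> bool"
  where "is_weak_divergence T m B \<beta> D \<longleftrightarrow> D \<in> CG T m \<and>
    (\<forall>\<eta> \<in> CG T m.
      mesh_integral T (\<lambda>K x. \<eta> x * (fst x * D x))
      = - mesh_integral T (\<lambda>K x. (fst x *\<^sub>R grad (region K) \<eta> x) \<bullet> B K x) - \<beta> \<eta>)"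

end

theory Submission
  imports Defs
begin

text \<open>The gradient of a continuous Galerkin field \<open>\<eta>\<close> is an admissible test field \<open>\<Sigma>\<close> with
  \<open>\<nabla>\<^sup>\<bottom> \<cdot> \<Sigma> = 0\<close>, so the equation for \<open>B\<close> expresses \<open>\<langle>r \<nabla>\<eta>, B\<rangle>\<close> as the boundary integral of
  \<open>\<Psi>\<close> times the tangential derivative of \<open>\<eta>\<close>. Since \<open>r g\<^sub>1\<close> is the tangential derivative of \<open>\<Psi>\<close>,
  integrating by parts along each straight boundary edge cancels this against the boundary term of
  \<open>D\<^sub>b\<close>, up to the endpoint values, which are the vertex masses; they telescope around the boundary
  when \<open>\<Psi>\<close> has a single trace. Hence \<open>\<langle>\<eta>, r D\<^sub>b\<rangle> = 0\<close> for all \<open>\<eta>\<close>, and \<open>\<eta> = D\<^sub>b\<close> gives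
  \<open>D\<^sub>b = 0\<close>.\<close>

section \<open>Reference maps\<close>

lemma perp_inner_self [simp]: "perp p \<bullet> p = 0"
  by (cases p) (simp add: perp_def)

lemma perp_inner_minus [simp]: "perp (p - q) \<bullet> (q - p) = 0"
  using perp_inner_self[of "p - q"] inner_minus_right[of "perp (p - q)" "p - q"] by simp

lemma perp_0 [simp]: "perp 0 = 0"
  by (simp add: perp_def zero_prod_def)

lemma perp_inner_swap: "perp p \<bullet> q = - (p \<bullet> perp q)"
  by (cases p; cases q) (simp add: perp_def)

lemma perp_bounded_linear: "bounded_linear perp"
  unfolding perp_def
  by (intro bounded_linear_Pair bounded_linear_minus bounded_linear_fst bounded_linear_snd)

lemmas perp_has_derivative [derivative_intros] = bounded_linear.has_derivative[OF perp_bounded_linear]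

text \<open>Affine and bilinear reference maps together: the affine ones have \<open>w = 0\<close>.\<close>

definition bilin :: "point \<Rightarrow> point \<Rightarrow> point \<Rightarrow> point \<Rightarrow> point \<Rightarrow> point"
  where "bilin a u v w x = a + fst x *\<^sub>R u + snd x *\<^sub>R v + (fst x * snd x) *\<^sub>R w"

text \<open>The Jacobian determinant of \<open>bilin\<close>: its partial derivatives are the two
  vectors paired here, and \<open>perp p \<bullet> q\<close> is the determinant with columns
  \<open>p\<close> and \<open>q\<close>.\<close>

definition bilin_jac :: "point \<Rightarrow> point \<Rightarrow> point \<Rightarrow> point \<Rightarrow> real"
  where "bilin_jac u v w x = perp (u + snd x *\<^sub>R w) \<bullet> (v + fst x *\<^sub>R w)"

text \<open>Common frame for triangle and square. The three vertices provide two independent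
  directions for one-sided derivatives, and the nonempty interior makes interior points dense in the
  convex set \<open>R\<close>.\<close>

locale reference_map =
  fixes a u v w :: point and R :: "point set"
  assumes convex_R: "convex R" and compact_R: "compact R"
    and vertices_R: "(0, 0) \<in> R" "(1, 0) \<in> R" "(0, 1) \<in> R"
    and int_R: "interior R \<noteq> {}"
    and jac_pos: "x \<in> R \<Longrightarrow> bilin_jac u v w x > 0"
begin

abbreviation F :: "point \<Rightarrow> point" where "F \<equiv> bilin a u v w"
abbreviation J :: "point \<Rightarrow> real" where "J \<equiv> bilin_jac u v w"

text \<open>\<open>P\<close> and \<open>Q\<close> are the columns of the Jacobian matrix of
  \<open>F\<close>.\<close>

definition P :: "point \<Rightarrow> point" where "P x = u + snd x *\<^sub>R w"
definition Q :: "point \<Rightarrow> point" where "Q x = v + fst x *\<^sub>R w"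
definition DF :: "point \<Rightarrow> point \<Rightarrow> point" where "DF x h = fst h *\<^sub>R P x + snd h *\<^sub>R Q x"
text \<open>The inverse of \<open>DF x\<close> by Cramer's rule.\<close>

definition DG :: "point \<Rightarrow> point \<Rightarrow> point"
  where "DG x y = (- (perp (Q x) \<bullet> y) / J x, (perp (P x) \<bullet> y) / J x)"

lemma J_eq: "J x = perp (P x) \<bullet> Q x"
  by (simp add: bilin_jac_def P_def Q_def)

lemma F_has_derivative: "(F has_derivative DF x) (at x within S)"
  unfolding bilin_def DF_def P_def Q_def
  by (rule derivative_eq_intros refl)+ (auto simp: algebra_simps fun_eq_iff)

lemma linear_DF: "linear (DF x)"
  using F_has_derivative[of x UNIV] has_derivative_linear by blast

lemma linear_DG: "linear (DG x)"
  unfolding DG_def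
  by (rule linearI) (auto simp: inner_add_right add_divide_distrib diff_divide_distrib)

lemma DG_DF: "J x \<noteq> 0 \<Longrightarrow> DG x (DF x h) = h"
  by (cases h; cases "P x"; cases "Q x")
    (simp add: DG_def DF_def J_eq perp_def field_simps)

lemma DF_DG:
  assumes "J x \<noteq> 0" shows "DF x (DG x y) = y"
proof -
  have "J x *\<^sub>R DF x (DG x y) = (- (perp (Q x) \<bullet> y)) *\<^sub>R P x + (perp (P x) \<bullet> y) *\<^sub>R Q x"
    using assms by (simp add: DF_def DG_def scaleR_right_distrib scaleR_right_diff_distrib)
  also have "\<dots> = J x *\<^sub>R y"
    by (cases y; cases "P x"; cases "Q x") (simp add: J_eq perp_def algebra_simps)
  finally show ?thesis using assms by simp
qed

text \<open>A quadratic map satisfies the mean value identity exactly at the midpoint.\<close>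

lemma F_diff: "F y - F x = DF ((1/2) *\<^sub>R (x + y)) (y - x)"
  unfolding bilin_def DF_def P_def Q_def
  by (cases x; cases y; cases u; cases v; cases w) (simp add: field_simps)

text \<open>By convexity the midpoint of two points of \<open>R\<close> lies in \<open>R\<close>,
  where the derivative is invertible; the exact mean value identity then turns equal values into
  equal arguments.\<close>

lemma F_inj: "inj_on F R"
proof (rule inj_onI)
  fix x y assume xy: "x \<in> R" "y \<in> R" "F x = F y"
  let ?m = "(1/2) *\<^sub>R (x + y)"
  have "?m \<in> R" using convexD[OF convex_R xy(1,2), of "1/2" "1/2"] by (simp add: scaleR_right_distrib)
  then have "J ?m \<noteq> 0" using jac_pos[of ?m] by simp
  moreover have "DF ?m (y - x) = DF ?m 0"
    using F_diff[of y x] xy(3) linear_0[OF linear_DF] by simp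
  ultimately show "x = y" by (metis DG_DF eq_iff_diff_eq_0)
qed

section \<open>Inverse of the reference map and differentiation on the image\<close>

definition G :: "point \<Rightarrow> point" where "G = the_inv_into R F"

lemma G_F: "x \<in> R \<Longrightarrow> G (F x) = x"
  by (simp add: G_def the_inv_into_f_f F_inj)

lemma F_continuous: "continuous_on S F"
  by (meson F_has_derivative continuous_on_eq_continuous_within has_derivative_continuous)

lemma G_continuous: "continuous_on (F ` R) G"
  unfolding G_def by (rule continuous_on_inv_into[OF F_continuous compact_R F_inj])

lemma compact_image: "compact (F ` R)"
  by (rule compact_continuous_image[OF F_continuous compact_R])

text \<open>The derivative is taken within the image, so corners are included. Continuity of the
  inverse comes from compactness of \<open>R\<close>, and invertibility of \<open>DF x\<close> does
  the rest.\<close>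

lemma G_has_derivative:
  assumes "x \<in> R" shows "(G has_derivative DG x) (at (F x) within F ` R)"
proof (rule has_derivative_inverse_within[OF F_has_derivative])
  show "continuous (at (F x) within F ` R) G"
    using G_continuous assms by (simp add: continuous_on_eq_continuous_within)
  show "DG x \<circ> DF x = id"
    using DG_DF jac_pos[OF assms] by (auto simp: fun_eq_iff)
qed (use assms linear_DG G_F in auto)

text \<open>Invariance of domain makes the image of \<open>interior R\<close> open, and continuity
  carries the density of \<open>interior R\<close> in \<open>R\<close> over to the image. This later
  extends an identity from the interior of a cell to the whole cell.\<close>

lemma image_subset_closure_interior: "F ` R \<subseteq> closure (interior (F ` R))"
proof -
  have "open (F ` interior R)"
    using invariance_of_domain[OF F_continuous open_interior] F_inj interior_subset
    by (meson inj_on_subset)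
  then have "F ` interior R \<subseteq> interior (F ` R)"
    by (meson image_mono interior_maximal interior_subset)
  then have "F ` interior R \<subseteq> closure (interior (F ` R))" using closure_subset by blast
  then have "F ` closure (interior R) \<subseteq> closure (interior (F ` R))"
    by (intro image_closure_subset[OF F_continuous]) auto
  then show ?thesis
    using convex_closure_interior[OF convex_R int_R] closure_subset by blast
qed

text \<open>The derivative within the image is determined even at corners: along segments inside the
  convex reference cell only one-dimensional derivatives are compared.\<close>

lemma derivative_unique:
  fixes f :: "point \<Rightarrow> 'b::euclidean_space"
  assumes x: "x \<in> R"
    and D: "(f has_derivative D) (at (F x) within F ` R)" "(f has_derivative E) (at (F x) within F ` R)"
  shows "D = E"
proof -
  have lin: "linear D" "linear E" using D has_derivative_linear by blast+
  have vec: "((\<lambda>t. f (F (x + t *\<^sub>R (y - x)))) has_vector_derivative L (DF x (y - x))) (at 0 within {0..1})"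
    if y: "y \<in> R" and L: "(f has_derivative L) (at (F x) within F ` R)" for y L
  proof -
    have sub: "(\<lambda>t. x + t *\<^sub>R (y - x)) ` {0..1} \<subseteq> R"
    proof (rule image_subsetI)
      fix t :: real assume "t \<in> {0..1}"
      then have "(1 - t) *\<^sub>R x + t *\<^sub>R y \<in> R" using convexD[OF convex_R x y] by simp
      then show "x + t *\<^sub>R (y - x) \<in> R" by (simp add: algebra_simps)
    qed
    have 1: "((\<lambda>t. x + t *\<^sub>R (y - x)) has_derivative (\<lambda>h. h *\<^sub>R (y - x))) (at 0 within {0..1})"
      by (auto intro!: derivative_eq_intros)
    have "((\<lambda>t. F (x + t *\<^sub>R (y - x))) has_derivative (\<lambda>h. DF x (h *\<^sub>R (y - x)))) (at 0 within {0..1})"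
      using has_derivative_compose[OF 1, of F "DF x"] F_has_derivative[of x] by simp
    from has_derivative_in_compose[OF this, of f L]
    have "((\<lambda>t. f (F (x + t *\<^sub>R (y - x)))) has_derivative (\<lambda>h. L (DF x (h *\<^sub>R (y - x))))) (at 0 within {0..1})"
      using has_derivative_subset[OF L, of "(\<lambda>t. F (x + t *\<^sub>R (y - x))) ` {0..1}"] sub by auto
    moreover have "L (DF x (h *\<^sub>R (y - x))) = h *\<^sub>R L (DF x (y - x))" for h
      using L has_derivative_linear linear_DF by (metis linear_scale)
    ultimately show ?thesis by (simp add: has_vector_derivative_def)
  qed
  have eq: "D (DF x (y - x)) = E (DF x (y - x))" if "y \<in> R" for y
    using vector_derivative_unique_within_closed_interval[of 0 "1::real" 0]
      vec[OF that D(1)] vec[OF that D(2)] by (simp add: cbox_interval)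
  \<comment> \<open>Linearity extends the agreement to differences of any two points of
    \<open>R\<close>; the reference vertices then supply both unit vectors, whatever the position of
    \<open>x\<close>.\<close>
  have eq': "D (DF x (y - z)) = E (DF x (y - z))" if "y \<in> R" "z \<in> R" for y z
  proof -
    have "DF x (y - z) = DF x (y - x) - DF x (z - x)"
      by (simp flip: linear_diff[OF linear_DF])
    then show ?thesis using eq[OF that(1)] eq[OF that(2)] lin by (simp add: linear_diff)
  qed
  have "D (DF x h) = E (DF x h)" for h
  proof -
    have e: "D (DF x (1, 0)) = E (DF x (1, 0))" "D (DF x (0, 1)) = E (DF x (0, 1))"
      using eq'[OF vertices_R(2,1)] eq'[OF vertices_R(3,1)] by (simp_all)
    have h: "DF x h = fst h *\<^sub>R DF x (1, 0) + snd h *\<^sub>R DF x (0, 1)"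
      by (simp add: DF_def)
    show ?thesis using e unfolding h by (simp add: linear_add[OF lin(1)] linear_add[OF lin(2)] linear_scale[OF lin(1)] linear_scale[OF lin(2)])
  qed
  then show ?thesis using DF_DG jac_pos[OF x] by (metis less_irrefl ext)
qed

text \<open>\<open>frechet_derivative\<close> is a choice among all derivatives, so computing it on
  a closed cell rests on uniqueness.\<close>

lemma frechet_derivative_image:
  fixes f :: "point \<Rightarrow> 'b::euclidean_space"
  assumes "x \<in> R" "(f has_derivative D) (at (F x) within F ` R)"
  shows "frechet_derivative f (at (F x) within F ` R) = D"
  using derivative_unique[OF assms(1) _ assms(2)] frechet_derivative_works assms(2)
  unfolding differentiable_def by blast

lemma grad_image:
  assumes "y \<in> F ` R" "(f has_derivative (\<lambda>h. g \<bullet> h)) (at y within F ` R)"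
  shows "grad (F ` R) f y = g"
  using assms frechet_derivative_image[of _ f "\<lambda>h. g \<bullet> h"]
  by (cases g) (auto simp: grad_def)

text \<open>The covariant Piola transform of \<open>(p\<^sub>1, p\<^sub>2)\<close>.\<close>

definition cov :: "(point \<Rightarrow> real) \<Rightarrow> (point \<Rightarrow> real) \<Rightarrow> point \<Rightarrow> point"
  where "cov p1 p2 x = (1 / J x) *\<^sub>R (p2 x *\<^sub>R perp (P x) - p1 x *\<^sub>R perp (Q x))"

text \<open>The characteristic property of the Piola transform: \<open>cov p1 p2 x\<close> is the
  inverse transpose of \<open>DF x\<close> applied to \<open>(p1 x, p2 x)\<close>.\<close>

lemma cov_inner_DF:
  assumes "J x \<noteq> 0"
  shows "cov p1 p2 x \<bullet> DF x h = p1 x * fst h + p2 x * snd h"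
proof -
  have "(p2 x *\<^sub>R perp (P x) - p1 x *\<^sub>R perp (Q x)) \<bullet> DF x h = J x * (p1 x * fst h + p2 x * snd h)"
    by (cases "P x"; cases "Q x") (simp add: DF_def J_eq perp_def algebra_simps)
  then show ?thesis using assms by (simp add: cov_def)
qed

text \<open>Chain rule, since \<open>f\<close> coincides with \<open>p\<close> composed with
  \<open>G\<close> on the image.\<close>

lemma pullback_has_derivative:
  assumes x: "x \<in> R" and f: "\<And>y. y \<in> R \<Longrightarrow> f (F y) = p y"
    and p: "(p has_derivative D) (at x)"
  shows "(f has_derivative (\<lambda>h. D (DG x h))) (at (F x) within F ` R)"
proof -
  have "(p has_derivative D) (at (G (F x)) within G ` F ` R)"
    using p G_F[OF x] has_derivative_at_withinI by metis
  from has_derivative_in_compose[OF G_has_derivative[OF x] this]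
  show ?thesis
    by (rule has_derivative_transform[rotated 2]) (use x f G_F in auto)
qed

text \<open>Gradients transform covariantly: the gradient on the image is the Piola transform of the
  reference gradient.\<close>

lemma pullback_has_gradient:
  assumes x: "x \<in> R" and f: "\<And>y. y \<in> R \<Longrightarrow> f (F y) = p y"
    and p: "(p has_derivative (\<lambda>h. p1 x * fst h + p2 x * snd h)) (at x)"
  shows "(f has_derivative (\<lambda>h. cov p1 p2 x \<bullet> h)) (at (F x) within F ` R)"
proof -
  have "J x \<noteq> 0" using jac_pos[OF x] by simp
  then have "p1 x * fst (DG x h) + p2 x * snd (DG x h) = cov p1 p2 x \<bullet> h" for h
    using cov_inner_DF[of x p1 p2 "DG x h"] DF_DG by simp
  then show ?thesis using pullback_has_derivative[OF assms] by simp
qed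

lemma J_has_derivative:
  "\<exists>D. (J has_derivative D) (at x)"
  unfolding bilin_jac_def by (rule exI) (rule derivative_eq_intros refl)+

lemma J_continuous: "continuous_on UNIV J"
  using J_has_derivative by (meson continuous_at_imp_continuous_on has_derivative_continuous)

lemma P_has_derivative [derivative_intros]: "(P has_derivative (\<lambda>h. snd h *\<^sub>R w)) (at x within S)"
  unfolding P_def by (rule derivative_eq_intros refl)+ simp

lemma Q_has_derivative [derivative_intros]: "(Q has_derivative (\<lambda>h. fst h *\<^sub>R w)) (at x within S)"
  unfolding Q_def by (rule derivative_eq_intros refl)+ simp

lemma cov_has_derivative:
  assumes "J x \<noteq> 0" "(p1 has_derivative D1) (at x)" "(p2 has_derivative D2) (at x)"
  shows "\<exists>D. (cov p1 p2 has_derivative D) (at x)"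
proof -
  obtain E where E: "(J has_derivative E) (at x)" using J_has_derivative by blast
  show ?thesis unfolding cov_def
    by (rule exI) (rule derivative_eq_intros refl E assms)+
qed

text \<open>Differentiating \<open>DF\<^sup>T A = (p\<^sub>s, p\<^sub>t)\<close> leaves, besides \<open>DF\<^sup>T DA DF\<close>, only terms symmetric in the two
  directions, so \<open>DA\<close> is symmetric.\<close>

lemma cov_derivative_symmetric:
  assumes J: "J x \<noteq> 0" and D: "(cov p1 p2 has_derivative D) (at x)"
    and p1: "(p1 has_derivative (\<lambda>h. pss * fst h + pst * snd h)) (at x)"
    and p2: "(p2 has_derivative (\<lambda>h. pst * fst h + ptt * snd h)) (at x)"
  shows "D k \<bullet> DF x h = D h \<bullet> DF x k"
proof -
  \<comment> \<open>The identity of \<open>cov_inner_DF\<close> holds only where \<open>J\<close> is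
    nonzero; it may be differentiated because this set is open.\<close>
  have op: "open {y. J y \<noteq> 0}"
    using open_Collect_neq[OF J_continuous continuous_on_const] by simp
  \<comment> \<open>Both sides differentiate \<open>cov p1 p2 \<bullet> DF h\<close> in the
    direction \<open>k\<close>. The term with \<open>w\<close> is the second derivative of
    \<open>F\<close>, which is symmetric in \<open>h\<close> and \<open>k\<close>, as is the
    right-hand side.\<close>
  have key: "D k \<bullet> DF x h + cov p1 p2 x \<bullet> ((fst h * snd k + snd h * fst k) *\<^sub>R w)
      = (pss * fst k + pst * snd k) * fst h + (pst * fst k + ptt * snd k) * snd h" for h k
  proof -
    have L: "((\<lambda>y. cov p1 p2 y \<bullet> DF y h) has_derivative
        (\<lambda>k. D k \<bullet> DF x h + cov p1 p2 x \<bullet> ((fst h * snd k + snd h * fst k) *\<^sub>R w))) (at x)"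
      unfolding DF_def
      by (rule derivative_eq_intros refl D)+ (simp add: fun_eq_iff algebra_simps)
    have "((\<lambda>y. p1 y * fst h + p2 y * snd h) has_derivative
        (\<lambda>k. (pss * fst k + pst * snd k) * fst h + (pst * fst k + ptt * snd k) * snd h)) (at x)"
      by (rule derivative_eq_intros refl p1 p2)+ simp
    then have "((\<lambda>y. cov p1 p2 y \<bullet> DF y h) has_derivative
        (\<lambda>k. (pss * fst k + pst * snd k) * fst h + (pst * fst k + ptt * snd k) * snd h)) (at x)"
      by (rule has_derivative_transform_within_open[OF _ op]) (use J cov_inner_DF in auto)
    from has_derivative_unique[OF L this] show ?thesis by metis
  qed
  show ?thesis using key[of k h] key[of h k] by (simp add: algebra_simps)
qed

text \<open>The curl of a gradient vanishes: \<open>pst\<close> in both hypotheses expresses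
  equality of the mixed derivatives on the reference cell, and the symmetry survives the
  transform.\<close>

lemma perp_div_pullback_gradient:
  assumes x: "x \<in> R" and A: "\<And>y. y \<in> R \<Longrightarrow> A (F y) = cov p1 p2 y"
    and p1: "(p1 has_derivative (\<lambda>h. pss * fst h + pst * snd h)) (at x)"
    and p2: "(p2 has_derivative (\<lambda>h. pst * fst h + ptt * snd h)) (at x)"
  shows "perp_div (F ` R) A (F x) = 0"
proof -
  have J: "J x \<noteq> 0" using jac_pos[OF x] by simp
  obtain D where D: "(cov p1 p2 has_derivative D) (at x)"
    using cov_has_derivative[OF J p1 p2] by blast
  have "frechet_derivative A (at (F x) within F ` R) = (\<lambda>h. D (DG x h))"
    using frechet_derivative_image[OF x pullback_has_derivative[OF x A D]] by simp
  \<comment> \<open>Choosing directions in the range of \<open>DG x\<close> removes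
    \<open>DF x\<close> and leaves symmetry in vectors of the image plane.\<close>
  moreover have "D (DG x y) \<bullet> z = D (DG x z) \<bullet> y" for y z
    using cov_derivative_symmetric[OF J D p1 p2, of "DG x y" "DG x z"] DF_DG[OF J] by simp
  from this[of "(1, 0)" "(0, 1)"]
  have "snd (D (DG x (1, 0))) = fst (D (DG x (0, 1)))" by (simp add: inner_prod_def)
  ultimately show ?thesis by (simp add: perp_div_def)
qed

end

section \<open>Edges of cells\<close>

lemma edges_image: "edges K = (\<lambda>i. (K ! i, K ! (Suc i mod length K))) ` {..<length K}"
  by (auto simp: edges_def)

lemma edges_triangle: "edges [a, b, c] = {(a, b), (b, c), (c, a)}"
  by (simp add: edges_image lessThan_Suc insert_commute)

lemma edges_quadrilateral: "edges [a, b, c, d] = {(a, b), (b, c), (c, d), (d, a)}"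
  by (simp add: edges_image lessThan_Suc insert_commute)

lemma is_cell_cases:
  assumes "is_cell K"
  obtains (triangle) a b c where "K = [a, b, c]" "perp (b - a) \<bullet> (c - b) > 0"
  | (quadrilateral) a b c d where "K = [a, b, c, d]"
      "perp (b - a) \<bullet> (c - b) > 0" "perp (c - b) \<bullet> (d - c) > 0"
      "perp (d - c) \<bullet> (a - d) > 0" "perp (a - d) \<bullet> (b - a) > 0"
proof -
  have turn: "\<And>i. i < length K \<Longrightarrow> perp (K ! (Suc i mod length K) - K ! i)
        \<bullet> (K ! (Suc (Suc i) mod length K) - K ! (Suc i mod length K)) > 0"
    and "length K \<in> {3, 4}" using assms by (auto simp: is_cell_def)
  then consider (3) "length K = 3" | (4) "length K = 4" by auto
  then show ?thesis
  proof cases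
    case 3
    then obtain a b c where K: "K = [a, b, c]" by (auto simp: numeral_3_eq_3 length_Suc_conv)
    show ?thesis using turn[of 0] by (intro triangle[OF K]) (simp add: K)
  next
    case 4
    then obtain a b c d where K: "K = [a, b, c, d]" by (auto simp: eval_nat_numeral length_Suc_conv)
    show ?thesis using turn[of 0] turn[of 1] turn[of 2] turn[of 3]
      by (intro quadrilateral[OF K]) (simp_all add: K)
  qed
qed

section \<open>Reference triangle and square, and their images\<close>

lemma ref_triangle:
  defines "R \<equiv> {(s, t). 0 \<le> s \<and> 0 \<le> t \<and> s + t \<le> (1::real)}"
  shows "convex R" "compact R" "interior R \<noteq> {}"
proof -
  have R: "R = {x. (- 1, 0) \<bullet> x \<le> 0} \<inter> {x. (0, - 1) \<bullet> x \<le> 0} \<inter> {x. (1, 1) \<bullet> x \<le> 1}"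
    by (auto simp: R_def)
  show "convex R" unfolding R by (intro convex_Int convex_halfspace_le)
  have "closed R" unfolding R by (intro closed_Int closed_halfspace_le)
  moreover have "bounded R"
    by (rule bounded_subset[OF bounded_cbox[of "(0, 0)" "(1, 1)"]]) (auto simp: R_def cbox_Pair_eq)
  ultimately show "compact R" by (simp add: compact_eq_bounded_closed)
  \<comment> \<open>Any small box works whose upper corner has coordinate sum below 1.\<close>
  have "box (1/8, 1/8) (1/4, 1/4) \<subseteq> R"
    by (auto simp: R_def mem_box Basis_prod_def)
  then have "box (1/8, 1/8) (1/4, 1/4) \<subseteq> interior R" by (rule interior_maximal) (rule open_box)
  moreover have "(3/16, 3/16) \<in> box (1/8, 1/8) (1/4::real, 1/4::real)"
    by (auto simp: mem_box Basis_prod_def)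
  ultimately show "interior R \<noteq> {}" by blast
qed

lemma ref_square:
  shows "convex ({0..1::real} \<times> {0..1::real})" "compact ({0..1::real} \<times> {0..1::real})"
    "interior ({0..1::real} \<times> {0..1::real}) \<noteq> {}"
  by (auto intro: convex_Times compact_Times simp: interior_Times)

text \<open>Placing the reference vertices in \<open>{0, 1}\<^sup>2\<close> records that none of them lies strictly
  between two others.\<close>

lemma cell_reference_map:
  assumes "is_cell K"
  obtains a u v w where "reference_map u v w (ref_cell K)" "cell_map K = bilin a u v w"
    "\<And>p q. (p, q) \<in> edges K \<Longrightarrow> \<exists>x \<in> ref_cell K \<inter> {0, 1} \<times> {0, 1}. \<exists>y \<in> ref_cell K \<inter> {0, 1} \<times> {0, 1}.
      x \<noteq> y \<and> (\<forall>t. bilin a u v w (x + t *\<^sub>R (y - x)) = p + t *\<^sub>R (q - p))"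
  using assms
proof (cases rule: is_cell_cases)
  case (triangle a b c)
  have R: "ref_cell K = {(s, t). 0 \<le> s \<and> 0 \<le> t \<and> s + t \<le> 1}"
    by (simp add: ref_cell_def triangle(1))
  have "perp (b - a) \<bullet> (c - a) = perp (b - a) \<bullet> (c - b)"
    by (cases a; cases b; cases c) (simp add: perp_def algebra_simps)
  with triangle(2) have "perp (b - a) \<bullet> (c - a) > 0" by simp
  then have "reference_map (b - a) (c - a) 0 (ref_cell K)"
    unfolding reference_map_def R using ref_triangle by (simp add: bilin_jac_def)
  moreover have "cell_map K = bilin a (b - a) (c - a) 0"
    by (auto simp: fun_eq_iff triangle(1) bilin_def)
  moreover have "\<exists>x \<in> ref_cell K \<inter> {0, 1} \<times> {0, 1}. \<exists>y \<in> ref_cell K \<inter> {0, 1} \<times> {0, 1}.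
      x \<noteq> y \<and> (\<forall>t. bilin a (b - a) (c - a) 0 (x + t *\<^sub>R (y - x)) = p + t *\<^sub>R (q - p))"
    if "(p, q) \<in> edges K" for p q
  proof -
    from that consider "p = a" "q = b" | "p = b" "q = c" | "p = c" "q = a"
      unfolding triangle(1) edges_triangle by blast
    then show ?thesis
    proof cases
      case 1 then show ?thesis
        by (intro bexI[of _ "(0, 0)"] bexI[of _ "(1, 0)"]) (auto simp: R bilin_def)
    next
      case 2 then show ?thesis
        by (intro bexI[of _ "(1, 0)"] bexI[of _ "(0, 1)"]) (auto simp: R bilin_def algebra_simps)
    next
      case 3 then show ?thesis
        by (intro bexI[of _ "(0, 1)"] bexI[of _ "(0, 0)"]) (auto simp: R bilin_def algebra_simps)
    qed
  qed
  ultimately show ?thesis by (rule that)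
next
  case (quadrilateral a b c d)
  let ?u = "b - a" and ?v = "d - a" and ?w = "a - b + c - d"
  have R: "ref_cell K = {0..1} \<times> {0..1}" by (simp add: ref_cell_def quadrilateral(1))
  have "bilin_jac ?u ?v ?w x > 0" if "x \<in> ref_cell K" for x
  proof -
    obtain s t where x: "x = (s, t)" by (cases x)
    have st: "0 \<le> s" "s \<le> 1" "0 \<le> t" "t \<le> 1" using that by (auto simp: R x)
    \<comment> \<open>The Jacobian is the bilinear interpolation of its corner values, which are the
      four turns; their minimum \<open>m\<close> bounds it from below.\<close>
    define m where "m = Min {perp (b - a) \<bullet> (c - b), perp (c - b) \<bullet> (d - c),
      perp (d - c) \<bullet> (a - d), perp (a - d) \<bullet> (b - a)}"
    have m: "m > 0" "m \<le> perp (b - a) \<bullet> (c - b)" "m \<le> perp (c - b) \<bullet> (d - c)"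
        "m \<le> perp (d - c) \<bullet> (a - d)" "m \<le> perp (a - d) \<bullet> (b - a)"
      using quadrilateral by (auto simp: m_def)
    have "m = (1 - s) * (1 - t) * m + s * (1 - t) * m + s * t * m + (1 - s) * t * m"
      by (simp add: algebra_simps)
    also have "\<dots> \<le> (1 - s) * (1 - t) * (perp (a - d) \<bullet> (b - a)) + s * (1 - t) * (perp (b - a) \<bullet> (c - b))
        + s * t * (perp (c - b) \<bullet> (d - c)) + (1 - s) * t * (perp (d - c) \<bullet> (a - d))"
      using st m by (intro add_mono mult_left_mono) auto
    also have "\<dots> = bilin_jac ?u ?v ?w x"
      by (cases a; cases b; cases c; cases d)
        (simp add: x bilin_jac_def perp_def algebra_simps)
    finally show ?thesis using m(1) by simp
  qed
  then have "reference_map ?u ?v ?w (ref_cell K)"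
    unfolding reference_map_def using ref_square by (simp add: R)
  moreover have "cell_map K = bilin a ?u ?v ?w"
    by (auto simp: fun_eq_iff quadrilateral(1) bilin_def algebra_simps)
  moreover have "\<exists>x \<in> ref_cell K \<inter> {0, 1} \<times> {0, 1}. \<exists>y \<in> ref_cell K \<inter> {0, 1} \<times> {0, 1}.
      x \<noteq> y \<and> (\<forall>t. bilin a ?u ?v ?w (x + t *\<^sub>R (y - x)) = p + t *\<^sub>R (q - p))"
    if "(p, q) \<in> edges K" for p q
  proof -
    \<comment> \<open>One reference coordinate is constant on each side of the square, so the
      bilinear map is affine there; the witnesses are the ends of that side.\<close>
    from that consider "p = a" "q = b" | "p = b" "q = c" | "p = c" "q = d" | "p = d" "q = a"
      unfolding quadrilateral(1) edges_quadrilateral by blast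
    then show ?thesis
    proof cases
      case 1 then show ?thesis
        by (intro bexI[of _ "(0, 0)"] bexI[of _ "(1, 0)"]) (auto simp: R bilin_def)
    next
      case 2 then show ?thesis
        by (intro bexI[of _ "(1, 0)"] bexI[of _ "(1, 1)"]) (auto simp: R bilin_def algebra_simps)
    next
      case 3 then show ?thesis
        by (intro bexI[of _ "(1, 1)"] bexI[of _ "(0, 1)"]) (auto simp: R bilin_def algebra_simps)
    next
      case 4 then show ?thesis
        by (intro bexI[of _ "(0, 1)"] bexI[of _ "(0, 0)"]) (auto simp: R bilin_def algebra_simps)
    qed
  qed
  ultimately show ?thesis by (rule that)
qed

lemma edge_subset_region:
  assumes "is_cell K" "(p, q) \<in> edges K" shows "closed_segment p q \<subseteq> region K"
proof -
  obtain a u v w where ref: "reference_map u v w (ref_cell K)" and F: "cell_map K = bilin a u v w"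
    and E: "\<And>p q. (p, q) \<in> edges K \<Longrightarrow> \<exists>x \<in> ref_cell K \<inter> {0, 1} \<times> {0, 1}. \<exists>y \<in> ref_cell K \<inter> {0, 1} \<times> {0, 1}.
      x \<noteq> y \<and> (\<forall>t. bilin a u v w (x + t *\<^sub>R (y - x)) = p + t *\<^sub>R (q - p))"
    using cell_reference_map[OF assms(1)] by metis
  interpret reference_map a u v w "ref_cell K" by (rule ref)
  from E[OF assms(2)] obtain x y where xy: "x \<in> ref_cell K" "y \<in> ref_cell K"
    "\<And>t. cell_map K (x + t *\<^sub>R (y - x)) = p + t *\<^sub>R (q - p)" unfolding F by blast
  show ?thesis
  proof
    fix z assume "z \<in> closed_segment p q"
    then obtain t where t: "0 \<le> t" "t \<le> 1" "z = p + t *\<^sub>R (q - p)"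
      by (auto simp: in_segment algebra_simps)
    have "x + t *\<^sub>R (y - x) = (1 - t) *\<^sub>R x + t *\<^sub>R y" by (simp add: algebra_simps)
    then have "x + t *\<^sub>R (y - x) \<in> ref_cell K" using convexD[OF convex_R xy(1,2), of "1 - t" t] t by simp
    then show "z \<in> region K" using xy(3)[of t] t(3) unfolding region_def by (metis image_eqI)
  qed
qed

text \<open>Injectivity moves the question to the reference cell, where a point of
  \<open>{0, 1} \<times> {0, 1}\<close> on a segment joining two distinct such points must be one of
  its ends.\<close>

lemma edges_vertex_on_edge:
  assumes K: "is_cell K" and e: "(p, q) \<in> edges K" and f: "(r, s) \<in> edges K \<or> (s, r) \<in> edges K"
    and r: "r \<in> closed_segment p q"
  shows "r = p \<or> r = q"
proof -
  obtain a u v w where ref: "reference_map u v w (ref_cell K)" and F: "cell_map K = bilin a u v w"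
    and E: "\<And>p q. (p, q) \<in> edges K \<Longrightarrow> \<exists>x \<in> ref_cell K \<inter> {0, 1} \<times> {0, 1}. \<exists>y \<in> ref_cell K \<inter> {0, 1} \<times> {0, 1}.
      x \<noteq> y \<and> (\<forall>t. bilin a u v w (x + t *\<^sub>R (y - x)) = p + t *\<^sub>R (q - p))"
    using cell_reference_map[OF K] by metis
  interpret reference_map a u v w "ref_cell K" by (rule ref)
  from E[OF e] obtain x y where xy: "x \<in> ref_cell K \<inter> {0, 1} \<times> {0, 1}"
    "y \<in> ref_cell K \<inter> {0, 1} \<times> {0, 1}" "x \<noteq> y" "\<And>t. F (x + t *\<^sub>R (y - x)) = p + t *\<^sub>R (q - p)"
    by blast
  have "\<exists>z \<in> ref_cell K \<inter> {0, 1} \<times> {0, 1}. F z = r"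
    using f
  proof
    assume "(r, s) \<in> edges K"
    from E[OF this] obtain x y where "x \<in> ref_cell K \<inter> {0, 1} \<times> {0, 1}"
      "\<And>t. F (x + t *\<^sub>R (y - x)) = r + t *\<^sub>R (s - r)" by blast
    from this(1) this(2)[of 0] show ?thesis by auto
  next
    assume "(s, r) \<in> edges K"
    from E[OF this] obtain x y where "y \<in> ref_cell K \<inter> {0, 1} \<times> {0, 1}"
      "\<And>t. F (x + t *\<^sub>R (y - x)) = s + t *\<^sub>R (r - s)" by blast
    from this(1) this(2)[of 1] show ?thesis by auto
  qed
  then obtain z where z: "z \<in> ref_cell K \<inter> {0, 1} \<times> {0, 1}" "F z = r" by blast
  from r obtain t where t: "0 \<le> t" "t \<le> 1" "r = p + t *\<^sub>R (q - p)"
    by (auto simp: in_segment algebra_simps)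
  have eq: "x + t *\<^sub>R (y - x) = (1 - t) *\<^sub>R x + t *\<^sub>R y" by (simp add: algebra_simps)
  have "x + t *\<^sub>R (y - x) \<in> ref_cell K"
    using convexD[OF convex_R, of x y "1 - t" t] xy t by (simp add: eq)
  then have "z = x + t *\<^sub>R (y - x)"
    using inj_onD[OF F_inj, of z "x + t *\<^sub>R (y - x)"] xy(4)[of t] t(3) z by simp
  \<comment> \<open>The ends differ in some coordinate, and there the point has the value
    \<open>t\<close> or \<open>1 - t\<close>, which must be 0 or 1.\<close>
  then have "t = 0 \<or> t = 1" using xy(1-3) z(1)
    by (cases x; cases y; cases z) auto
  then show ?thesis using t(3) by auto
qed

text \<open>Coinciding vertices make a turn vanish: neighbours give a zero edge, opposite vertices
  two antiparallel consecutive edges.\<close>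

lemma is_cell_distinct:
  assumes "is_cell K" shows "distinct K"
  using assms
proof (cases rule: is_cell_cases)
  case (triangle a b c)
  then show ?thesis by auto
next
  case (quadrilateral a b c d)
  then show ?thesis by auto
qed

lemma edges_neq:
  assumes "is_cell K" "(p, q) \<in> edges K" shows "p \<noteq> q"
  using assms(1)
proof (cases rule: is_cell_cases)
  case (triangle a b c)
  then show ?thesis using assms(2) is_cell_distinct[OF assms(1)] by (auto simp: edges_triangle)
next
  case (quadrilateral a b c d)
  then show ?thesis using assms(2) is_cell_distinct[OF assms(1)] by (auto simp: edges_quadrilateral)
qed

lemma edges_antisym:
  assumes "is_cell K" "(p, q) \<in> edges K" shows "(q, p) \<notin> edges K"
  using assms(1)
proof (cases rule: is_cell_cases)
  case (triangle a b c)
  then show ?thesis using assms(2) is_cell_distinct[OF assms(1)] by (auto simp: edges_triangle)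
next
  case (quadrilateral a b c d)
  then show ?thesis using assms(2) is_cell_distinct[OF assms(1)] by (auto simp: edges_quadrilateral)
qed

lemma finite_edges [simp]: "finite (edges K)"
  by (simp add: edges_def)

lemma edges_vertices: "(p, q) \<in> edges K \<Longrightarrow> p \<in> set K \<and> q \<in> set K"
  by (auto simp: edges_def intro!: nth_mem mod_less_divisor)

text \<open>The edges form a closed cycle, so the differences telescope.\<close>

lemma sum_edges_eq_0:
  fixes \<phi> :: "point \<Rightarrow> real"
  assumes "is_cell K" shows "(\<Sum>(p, q)\<in>edges K. \<phi> q - \<phi> p) = 0"
  using assms
proof (cases rule: is_cell_cases)
  case (triangle a b c)
  then show ?thesis using is_cell_distinct[OF assms] by (simp add: edges_triangle)
next
  case (quadrilateral a b c d)
  then show ?thesis using is_cell_distinct[OF assms] by (simp add: edges_quadrilateral)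
qed

section \<open>Interior and boundary edges of a mesh\<close>

lemma is_mesh_cell: "is_mesh T \<Longrightarrow> K \<in> T \<Longrightarrow> is_cell K"
  by (simp add: is_mesh_def)

text \<open>Two distinct cells with this directed edge would meet in more than a point, hence in a
  whole edge traversed oppositely. Its ends must be \<open>p\<close> and \<open>q\<close>, so one
  cell would contain the edge in both directions.\<close>

lemma shared_edge_unique:
  assumes T: "is_mesh T" and K: "K \<in> T" "K' \<in> T"
    and e: "(p, q) \<in> edges K" "(p, q) \<in> edges K'"
  shows "K = K'"
proof (rule ccontr)
  assume "K \<noteq> K'"
  have cell: "is_cell K" "is_cell K'" using is_mesh_cell[OF T] K by auto
  have sub: "closed_segment p q \<subseteq> region K \<inter> region K'"
    using edge_subset_region cell e by simp
  have ne: "p \<noteq> q" using edges_neq cell e by blast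
  have "p \<in> region K \<inter> region K'" "q \<in> region K \<inter> region K'" using sub by auto
  moreover have "region K \<inter> region K' = {} \<or>
      (\<exists>v \<in> set K \<inter> set K'. region K \<inter> region K' = {v}) \<or>
      (\<exists>a b. (a, b) \<in> edges K \<and> (b, a) \<in> edges K' \<and> region K \<inter> region K' = closed_segment a b)"
    using T K \<open>K \<noteq> K'\<close> unfolding is_mesh_def by blast
  moreover have "region K \<inter> region K' \<noteq> {v}" for v
    using calculation(1,2) ne by (metis singletonD)
  ultimately obtain a b where ab: "(a, b) \<in> edges K" "(b, a) \<in> edges K'"
    "p \<in> closed_segment a b" "q \<in> closed_segment a b" by blast
  then have "p = a \<or> p = b" "q = a \<or> q = b"
    using edges_vertex_on_edge[OF cell(1) ab(1)] e(1) by blast+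
  then show False using ne ab e edges_antisym cell by metis
qed

lemma finite_boundary_edges:
  assumes "is_mesh T" shows "finite (boundary_edges T)"
proof -
  have "boundary_edges T \<subseteq> (SIGMA K:T. edges K)" by (auto simp: boundary_edges_def)
  moreover have "finite (SIGMA K:T. edges K)" using assms by (auto simp: is_mesh_def)
  ultimately show ?thesis by (rule finite_subset)
qed

text \<open>Interior edges cancel in pairs because they are traversed in both directions.\<close>

lemma sum_boundary_edges_eq_0:
  fixes \<phi> :: "point \<Rightarrow> real"
  assumes T: "is_mesh T"
  shows "(\<Sum>(K, p, q)\<in>boundary_edges T. \<phi> q - \<phi> p) = 0"
proof -
  define E where "E = (SIGMA K:T. edges K)"
  define I where "I = {(K, p, q). K \<in> T \<and> (p, q) \<in> edges K \<and> (\<exists>K'\<in>T. (q, p) \<in> edges K')}"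
  have T': "finite T" "\<And>K. K \<in> T \<Longrightarrow> is_cell K" using T by (auto simp: is_mesh_def)
  have fin: "finite E" using T' by (auto simp: E_def)
  have split: "E = boundary_edges T \<union> I" "boundary_edges T \<inter> I = {}"
    by (auto simp: E_def I_def boundary_edges_def)
  have "(\<Sum>(K, p, q)\<in>E. \<phi> q - \<phi> p) = (\<Sum>K\<in>T. \<Sum>(p, q)\<in>edges K. \<phi> q - \<phi> p)"
    unfolding E_def using T' by (simp add: sum.Sigma)
  also have "\<dots> = 0" using sum_edges_eq_0 T' by simp
  finally have sumE: "(\<Sum>(K, p, q)\<in>E. \<phi> q - \<phi> p) = 0" .
  define S where "S = snd ` I"
  have "inj_on snd I" using shared_edge_unique[OF T] by (auto simp: inj_on_def I_def)
  then have "(\<Sum>(K, p, q)\<in>I. \<phi> q - \<phi> p) = (\<Sum>(p, q)\<in>S. \<phi> q - \<phi> p)"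
    unfolding S_def by (simp add: sum.reindex case_prod_unfold)
  also have "\<dots> = 0"
  proof -
    \<comment> \<open>Reversal permutes the interior edges and changes the sign of each summand, so
      the sum equals its negative.\<close>
    have "prod.swap ` S = S"
    proof -
      have "prod.swap e \<in> S" if "e \<in> S" for e
        using that by (force simp: S_def I_def)
      then show ?thesis by (force intro: rev_image_eqI)
    qed
    then have "(\<Sum>(p, q)\<in>S. \<phi> q - \<phi> p) = (\<Sum>(p, q)\<in>prod.swap ` S. \<phi> q - \<phi> p)" by simp
    also have "\<dots> = (\<Sum>(p, q)\<in>S. \<phi> p - \<phi> q)"
      by (subst sum.reindex) (auto simp: case_prod_unfold)
    also have "\<dots> = - (\<Sum>(p, q)\<in>S. \<phi> q - \<phi> p)"
      by (simp add: case_prod_unfold flip: sum_negf)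
    finally show ?thesis by simp
  qed
  finally have sumI: "(\<Sum>(K, p, q)\<in>I. \<phi> q - \<phi> p) = 0" .
  have "finite (boundary_edges T)" "finite I" using fin split(1) by auto
  from sum.union_disjoint[OF this split(2), of "\<lambda>(K, p, q). \<phi> q - \<phi> p"]
  show ?thesis using sumE sumI split(1) by simp
qed

section \<open>Gradients of continuous Galerkin fields\<close>

lemma poly_span_0 [simp]: "(\<lambda>x. 0) \<in> poly_span I"
  by (auto simp: poly_span_def intro: exI[of _ "\<lambda>_ _. 0"])

lemma poly_span_add:
  assumes "p \<in> poly_span I" "q \<in> poly_span I" shows "(\<lambda>x. p x + q x) \<in> poly_span I"
proof -
  from assms obtain c d where "\<forall>s t. p (s, t) = (\<Sum>(i, j)\<in>I. c i j * s ^ i * t ^ j)"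
    "\<forall>s t. q (s, t) = (\<Sum>(i, j)\<in>I. d i j * s ^ i * t ^ j)" by (auto simp: poly_span_def)
  then show ?thesis unfolding poly_span_def
    by (auto intro!: exI[of _ "\<lambda>i j. c i j + d i j"] simp: algebra_simps case_prod_unfold simp flip: sum.distrib)
qed

lemma poly_span_sum:
  "(\<And>e. e \<in> A \<Longrightarrow> p e \<in> poly_span I) \<Longrightarrow> (\<lambda>x. \<Sum>e\<in>A. p e x) \<in> poly_span I"
  by (induction A rule: infinite_finite_induct) (auto intro: poly_span_add)

lemma poly_span_monomial:
  assumes "finite I" "(i, j) \<in> I" shows "(\<lambda>x. c * fst x ^ i * snd x ^ j) \<in> poly_span I"
proof -
  have "c * s ^ i * t ^ j = (\<Sum>(k, l)\<in>I. (if (k, l) = (i, j) then c else 0) * s ^ k * t ^ l)" for s t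
  proof -
    have "(\<Sum>(k, l)\<in>I. (if (k, l) = (i, j) then c else 0) * s ^ k * t ^ l)
        = (\<Sum>e\<in>I. if e = (i, j) then c * s ^ i * t ^ j else 0)"
      by (rule sum.cong) (auto split: if_splits)
    then show ?thesis using assms by simp
  qed
  then show ?thesis unfolding poly_span_def by (auto intro!: exI[of _ "\<lambda>k l. if (k, l) = (i, j) then c else 0"])
qed

text \<open>The exponents are arbitrary functions of the index, so the rule applies again to the
  differentiated sums. Truncation in \<open>f e - 1\<close> is harmless because the factor
  \<open>f e\<close> is then zero.\<close>

lemma sum_monomials_has_derivative:
  fixes c :: "'a \<Rightarrow> real" and f g :: "'a \<Rightarrow> nat"
  shows "((\<lambda>x. \<Sum>e\<in>I. c e * fst x ^ f e * snd x ^ g e) has_derivative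
    (\<lambda>h. (\<Sum>e\<in>I. (c e * f e) * fst x ^ (f e - 1) * snd x ^ g e) * fst h
       + (\<Sum>e\<in>I. (c e * g e) * fst x ^ f e * snd x ^ (g e - 1)) * snd h)) (at x)"
proof -
  have "((\<lambda>x. c e * fst x ^ f e * snd x ^ g e) has_derivative
      (\<lambda>h. (c e * f e) * fst x ^ (f e - 1) * snd x ^ g e * fst h
        + (c e * g e) * fst x ^ f e * snd x ^ (g e - 1) * snd h)) (at x)" for e
    by (rule derivative_eq_intros refl)+ (simp add: fun_eq_iff algebra_simps)
  from has_derivative_sum[of I, OF this] show ?thesis
    by (simp add: sum_distrib_right sum.distrib)
qed

text \<open>The single \<open>pst\<close> makes equality of mixed derivatives explicit;
  \<open>Is\<close> and \<open>It\<close> collect the lowered exponents.\<close>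

lemma poly_span_derivatives:
  assumes p: "p \<in> poly_span I" and fin: "finite Is" "finite It"
    and I: "\<And>i j. (i, j) \<in> I \<Longrightarrow> i > 0 \<Longrightarrow> (i - 1, j) \<in> Is"
      "\<And>i j. (i, j) \<in> I \<Longrightarrow> j > 0 \<Longrightarrow> (i, j - 1) \<in> It"
  obtains ps pt pss pst ptt where "ps \<in> poly_span Is" "pt \<in> poly_span It"
    "\<And>x. (p has_derivative (\<lambda>h. ps x * fst h + pt x * snd h)) (at x)"
    "\<And>x. (ps has_derivative (\<lambda>h. pss x * fst h + pst x * snd h)) (at x)"
    "\<And>x. (pt has_derivative (\<lambda>h. pst x * fst h + ptt x * snd h)) (at x)"
proof -
  from p obtain c where c: "\<forall>s t. p (s, t) = (\<Sum>(i, j)\<in>I. c i j * s ^ i * t ^ j)"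
    by (auto simp: poly_span_def)
  define d where "d e = c (fst e) (snd e)" for e
  have p_eq: "p = (\<lambda>x. \<Sum>e\<in>I. d e * fst x ^ fst e * snd x ^ snd e)"
    using c by (auto simp: d_def case_prod_unfold)
  define ps where "ps x = (\<Sum>e\<in>I. (d e * fst e) * fst x ^ (fst e - 1) * snd x ^ snd e)" for x :: point
  define pt where "pt x = (\<Sum>e\<in>I. (d e * snd e) * fst x ^ fst e * snd x ^ (snd e - 1))" for x :: point
  have "(\<lambda>x. (d e * fst e) * fst x ^ (fst e - 1) * snd x ^ snd e) \<in> poly_span Is" if "e \<in> I" for e
    using that I(1)[of "fst e" "snd e"] by (cases "fst e = 0") (auto intro: poly_span_monomial fin)
  then have "ps \<in> poly_span Is" unfolding ps_def by (rule poly_span_sum)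
  moreover have "(\<lambda>x. (d e * snd e) * fst x ^ fst e * snd x ^ (snd e - 1)) \<in> poly_span It" if "e \<in> I" for e
    using that I(2)[of "fst e" "snd e"] by (cases "snd e = 0") (auto intro: poly_span_monomial fin)
  then have "pt \<in> poly_span It" unfolding pt_def by (rule poly_span_sum)
  moreover have "(p has_derivative (\<lambda>h. ps x * fst h + pt x * snd h)) (at x)" for x
    unfolding p_eq ps_def pt_def by (rule sum_monomials_has_derivative)
  moreover have "(ps has_derivative (\<lambda>h. (\<Sum>e\<in>I. (d e * fst e * real (fst e - 1)) * fst x ^ (fst e - 1 - 1) * snd x ^ snd e) * fst h
      + (\<Sum>e\<in>I. (d e * fst e * snd e) * fst x ^ (fst e - 1) * snd x ^ (snd e - 1)) * snd h)) (at x)" for x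
    unfolding ps_def by (rule sum_monomials_has_derivative)
  moreover have "(pt has_derivative (\<lambda>h. (\<Sum>e\<in>I. (d e * fst e * snd e) * fst x ^ (fst e - 1) * snd x ^ (snd e - 1)) * fst h
      + (\<Sum>e\<in>I. (d e * snd e * real (snd e - 1)) * fst x ^ fst e * snd x ^ (snd e - 1 - 1)) * snd h)) (at x)" for x
    using sum_monomials_has_derivative[where I = I and c = "\<lambda>e. d e * snd e" and f = fst and g = "\<lambda>e. snd e - 1" and x = x]
    unfolding pt_def by (simp add: mult.commute mult.left_commute)
  ultimately show ?thesis by (rule that)
qed

text \<open>The gradient step of the discrete complex on the reference cell. On triangles the
  gradient has degree \<open>m - 1\<close> and needs only the full polynomial part; on squares each
  derivative lowers the degree in its own variable, as the two components of
  \<open>ref_Hcurl\<close> require.\<close>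

lemma ref_CG_derivatives:
  assumes p: "p \<in> ref_CG K m" and m: "m \<ge> 1"
  obtains ps pt pss pst ptt where "(\<lambda>x. (ps x, pt x)) \<in> ref_Hcurl K m"
    "\<And>x. (p has_derivative (\<lambda>h. ps x * fst h + pt x * snd h)) (at x)"
    "\<And>x. (ps has_derivative (\<lambda>h. pss x * fst h + pst x * snd h)) (at x)"
    "\<And>x. (pt has_derivative (\<lambda>h. pst x * fst h + ptt x * snd h)) (at x)"
proof (cases "length K = 3")
  case True
  have fin: "finite {(i, j). i + j \<le> m - 1}"
    by (rule finite_subset[of _ "{..m} \<times> {..m}"]) auto
  have p': "p \<in> poly_span {(i, j). i + j \<le> m}" using p True by (simp add: ref_CG_def)
  have I: "(i - 1, j) \<in> {(i, j). i + j \<le> m - 1}" if "(i, j) \<in> {(i, j). i + j \<le> m}" "i > 0" for i j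
    using that by auto
  have I': "(i, j - 1) \<in> {(i, j). i + j \<le> m - 1}" if "(i, j) \<in> {(i, j). i + j \<le> m}" "j > 0" for i j
    using that by auto
  from poly_span_derivatives[OF p' fin fin I I'] obtain ps pt pss pst ptt where
    D: "ps \<in> poly_span {(i, j). i + j \<le> m - 1}" "pt \<in> poly_span {(i, j). i + j \<le> m - 1}"
    "\<And>x. (p has_derivative (\<lambda>h. ps x * fst h + pt x * snd h)) (at x)"
    "\<And>x. (ps has_derivative (\<lambda>h. pss x * fst h + pst x * snd h)) (at x)"
    "\<And>x. (pt has_derivative (\<lambda>h. pst x * fst h + ptt x * snd h)) (at x)" by blast
  have "(\<lambda>x. (ps x, pt x)) \<in> ref_Hcurl K m"
    unfolding ref_Hcurl_def if_P[OF True] mem_Collect_eq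
    by (rule exI[of _ ps], rule exI[of _ pt], rule exI[of _ "\<lambda>x. 0"], intro conjI D(1,2) poly_span_0) simp
  then show ?thesis using D(3-) by (rule that)
next
  case False
  have "p \<in> poly_span ({..m} \<times> {..m})" using p False by (simp add: ref_CG_def)
  then have "\<exists>ps pt pss pst ptt. ps \<in> poly_span ({..m - 1} \<times> {..m}) \<and> pt \<in> poly_span ({..m} \<times> {..m - 1}) \<and>
    (\<forall>x. (p has_derivative (\<lambda>h. ps x * fst h + pt x * snd h)) (at x)) \<and>
    (\<forall>x. (ps has_derivative (\<lambda>h. pss x * fst h + pst x * snd h)) (at x)) \<and>
    (\<forall>x. (pt has_derivative (\<lambda>h. pst x * fst h + ptt x * snd h)) (at x))"
    by (rule poly_span_derivatives[where Is = "{..m - 1} \<times> {..m}" and It = "{..m} \<times> {..m - 1}"]) (auto, blast)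
  then
  obtain ps pt pss pst ptt where
    D: "ps \<in> poly_span ({..m - 1} \<times> {..m})" "pt \<in> poly_span ({..m} \<times> {..m - 1})"
    "\<And>x. (p has_derivative (\<lambda>h. ps x * fst h + pt x * snd h)) (at x)"
    "\<And>x. (ps has_derivative (\<lambda>h. pss x * fst h + pst x * snd h)) (at x)"
    "\<And>x. (pt has_derivative (\<lambda>h. pst x * fst h + ptt x * snd h)) (at x)" by blast
  have "(\<lambda>x. (ps x, pt x)) \<in> ref_Hcurl K m"
    using False D(1,2) by (auto simp: ref_Hcurl_def)
  then show ?thesis using D(3-) by (rule that)
qed

section \<open>Gradients on physical cells\<close>

lemma grad_region:
  assumes K: "is_cell K" and y: "y \<in> region K"
    and f: "(f has_derivative (\<lambda>h. g \<bullet> h)) (at y within region K)"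
  shows "grad (region K) f y = g"
proof -
  obtain a u v w where ref: "reference_map u v w (ref_cell K)" and F: "cell_map K = bilin a u v w"
    using cell_reference_map[OF K] by metis
  interpret reference_map a u v w "ref_cell K" by (rule ref)
  show ?thesis using grad_image[of y f g] y f by (simp add: region_def F)
qed

text \<open>All four claims follow from identifying the gradient with the Piola transform
  \<open>cov ps pt\<close> of the reference gradient.\<close>

lemma grad_galerkin:
  assumes K: "is_cell K" and m: "m \<ge> 1" and p: "p \<in> ref_CG K m"
    and f: "\<And>x. x \<in> ref_cell K \<Longrightarrow> f (cell_map K x) = p x"
  shows "\<exists>A \<in> ref_Hcurl K m. \<forall>x \<in> ref_cell K. \<forall>h.
      grad (region K) f (cell_map K x) \<bullet> frechet_derivative (cell_map K) (at x) h = A x \<bullet> h"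
    and "y \<in> region K \<Longrightarrow> (f has_derivative (\<lambda>h. grad (region K) f y \<bullet> h)) (at y within region K)"
    and "continuous_on (region K) (grad (region K) f)"
    and "y \<in> region K \<Longrightarrow> perp_div (region K) (grad (region K) f) y = 0"
proof -
  obtain a u v w where ref: "reference_map u v w (ref_cell K)" and F: "cell_map K = bilin a u v w"
    using cell_reference_map[OF K] by metis
  interpret reference_map a u v w "ref_cell K" by (rule ref)
  have reg: "region K = F ` ref_cell K" by (simp add: region_def F)
  obtain ps pt pss pst ptt where D: "(\<lambda>x. (ps x, pt x)) \<in> ref_Hcurl K m"
    "\<And>x. (p has_derivative (\<lambda>h. ps x * fst h + pt x * snd h)) (at x)"
    "\<And>x. (ps has_derivative (\<lambda>h. pss x * fst h + pst x * snd h)) (at x)"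
    "\<And>x. (pt has_derivative (\<lambda>h. pst x * fst h + ptt x * snd h)) (at x)"
    using ref_CG_derivatives[OF p m] by blast
  have d: "(f has_derivative (\<lambda>h. cov ps pt x \<bullet> h)) (at (F x) within F ` ref_cell K)"
    if "x \<in> ref_cell K" for x
    using pullback_has_gradient[where p = p and f = f and ?p1.0 = ps and ?p2.0 = pt, OF that _ D(2)] f by (simp add: F)
  have g: "grad (region K) f (F x) = cov ps pt x" if "x \<in> ref_cell K" for x
    using grad_image[OF _ d[OF that]] that by (simp add: reg)
  have J: "J x \<noteq> 0" if "x \<in> ref_cell K" for x using jac_pos[OF that] by simp
  have fr: "frechet_derivative F (at x) = DF x" for x
    using frechet_derivative_at[OF F_has_derivative] by metis
  show "\<exists>A \<in> ref_Hcurl K m. \<forall>x \<in> ref_cell K. \<forall>h.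
      grad (region K) f (cell_map K x) \<bullet> frechet_derivative (cell_map K) (at x) h = A x \<bullet> h"
  proof (rule bexI[OF _ D(1)], intro ballI allI)
    fix x h assume "x \<in> ref_cell K"
    then show "grad (region K) f (cell_map K x) \<bullet> frechet_derivative (cell_map K) (at x) h = (ps x, pt x) \<bullet> h"
      unfolding F fr by (cases h) (simp add: g cov_inner_DF J)
  qed
  show "(f has_derivative (\<lambda>h. grad (region K) f y \<bullet> h)) (at y within region K)" if "y \<in> region K"
    using that d g by (auto simp: reg)
  show "perp_div (region K) (grad (region K) f) y = 0" if "y \<in> region K"
    using that perp_div_pullback_gradient[OF _ g D(3,4)] by (auto simp: reg)
  have "\<exists>E. (grad (region K) f has_derivative E) (at (F x) within region K)" if x: "x \<in> ref_cell K" for x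
    using pullback_has_derivative[where f = "grad (region K) f" and p = "cov ps pt", OF x g] cov_has_derivative[OF J[OF x] D(3,4)] unfolding reg by blast
  then show "continuous_on (region K) (grad (region K) f)"
    unfolding continuous_on_eq_continuous_within reg using has_derivative_continuous by blast
qed

section \<open>Calculus along a straight segment\<close>

lemma segment_image:
  fixes p q :: "'a::real_vector"
  shows "(\<lambda>t. p + t *\<^sub>R (q - p)) ` {0..1} = closed_segment p q"
  unfolding closed_segment_image_interval by (rule image_cong) (simp_all add: algebra_simps)

lemma segment_has_vector_derivative:
  fixes f :: "'a::real_inner \<Rightarrow> real"
  assumes S: "closed_segment p q \<subseteq> S" and t: "t \<in> {0..1}"
    and f: "(f has_derivative (\<lambda>h. g \<bullet> h)) (at (p + t *\<^sub>R (q - p)) within S)"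
  shows "((\<lambda>t. f (p + t *\<^sub>R (q - p))) has_vector_derivative g \<bullet> (q - p)) (at t within {0..1})"
proof -
  have sub: "(\<lambda>t. p + t *\<^sub>R (q - p)) ` {0..1} \<subseteq> S"
    using S by (simp add: segment_image)
  have "((\<lambda>t. p + t *\<^sub>R (q - p)) has_derivative (\<lambda>h. h *\<^sub>R (q - p))) (at t within {0..1})"
    by (auto intro!: derivative_eq_intros)
  from has_derivative_in_compose[OF this has_derivative_subset[OF f sub]]
  show ?thesis by (simp add: has_vector_derivative_def mult.commute)
qed

text \<open>Product rule and fundamental theorem on the parameter interval; on a straight segment
  the tangent \<open>q - p\<close> is constant.\<close>

lemma segment_integration_by_parts:
  fixes f g :: "'a::real_inner \<Rightarrow> real" and p q :: 'a
  defines "\<gamma> \<equiv> \<lambda>t::real. p + t *\<^sub>R (q - p)"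
  assumes S: "closed_segment p q \<subseteq> S"
    and f: "\<And>x. x \<in> S \<Longrightarrow> (f has_derivative (\<lambda>h. f' x \<bullet> h)) (at x within S)" "continuous_on S f'"
    and g: "\<And>x. x \<in> S \<Longrightarrow> (g has_derivative (\<lambda>h. g' x \<bullet> h)) (at x within S)" "continuous_on S g'"
  shows "integral {0..1} (\<lambda>t. g (\<gamma> t) * (f' (\<gamma> t) \<bullet> (q - p)))
    + integral {0..1} (\<lambda>t. f (\<gamma> t) * (g' (\<gamma> t) \<bullet> (q - p))) = f q * g q - f p * g p"
proof -
  have sub: "\<gamma> ` {0..1} \<subseteq> S"
    using S by (simp add: segment_image \<gamma>_def)
  have cont: "continuous_on {0..1} (\<lambda>t. h (\<gamma> t))" if "continuous_on S h" for h :: "'a \<Rightarrow> 'b::topological_space"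
    by (rule continuous_on_compose2[OF that _ sub]) (auto simp: \<gamma>_def intro!: continuous_intros)
  have fg: "continuous_on S f" "continuous_on S g"
    using f g by (meson continuous_on_eq_continuous_within has_derivative_continuous)+
  have int: "(\<lambda>t. g (\<gamma> t) * (f' (\<gamma> t) \<bullet> (q - p))) integrable_on {0..1}"
    "(\<lambda>t. f (\<gamma> t) * (g' (\<gamma> t) \<bullet> (q - p))) integrable_on {0..1}"
    by (intro integrable_continuous_real continuous_intros cont fg f g)+
  have "((\<lambda>t. f (\<gamma> t) * g (\<gamma> t)) has_vector_derivative
      g (\<gamma> t) * (f' (\<gamma> t) \<bullet> (q - p)) + f (\<gamma> t) * (g' (\<gamma> t) \<bullet> (q - p))) (at t within {0..1})"
    if t: "t \<in> {0..1}" for t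
  proof -
    have "\<gamma> t \<in> S" using sub t by blast
    from has_vector_derivative_mult[OF segment_has_vector_derivative[OF S t f(1)[OF this, unfolded \<gamma>_def]]
        segment_has_vector_derivative[OF S t g(1)[OF this, unfolded \<gamma>_def]]]
    show ?thesis by (simp add: \<gamma>_def algebra_simps)
  qed
  then have "((\<lambda>t. g (\<gamma> t) * (f' (\<gamma> t) \<bullet> (q - p)) + f (\<gamma> t) * (g' (\<gamma> t) \<bullet> (q - p)))
      has_integral f (\<gamma> 1) * g (\<gamma> 1) - f (\<gamma> 0) * g (\<gamma> 0)) {0..1}"
    by (intro fundamental_theorem_of_calculus) auto
  then show ?thesis using int by (simp add: \<gamma>_def integral_unique flip: integral_add)
qed

text \<open>Gradients from two adjacent cells may differ on a shared edge, but both tangential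
  components are the derivative of the one function \<eta> along that edge.\<close>

lemma grad_in_Hcurl:
  assumes T: "is_mesh T" and m: "m \<ge> 1" and \<eta>: "\<eta> \<in> CG T m"
  shows "(\<lambda>K. grad (region K) \<eta>) \<in> Hcurl T m"
proof -
  have cell: "is_cell K" if "K \<in> T" for K by (rule is_mesh_cell[OF T that])
  have p: "\<exists>p \<in> ref_CG K m. \<forall>x \<in> ref_cell K. \<eta> (cell_map K x) = p x" if "K \<in> T" for K
    using \<eta> that by (auto simp: CG_def)
  have "grad (region K) \<eta> x \<bullet> (b - a) = grad (region K') \<eta> x \<bullet> (b - a)"
    if K: "K \<in> T" "K' \<in> T" and e: "(a, b) \<in> edges K" "(b, a) \<in> edges K'" and x: "x \<in> closed_segment a b"
    for K K' a b x
  proof -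
    obtain t where t: "t \<in> {0..1}" "x = a + t *\<^sub>R (b - a)"
      using x by (auto simp: in_segment algebra_simps)
    have sub: "closed_segment a b \<subseteq> region K" "closed_segment a b \<subseteq> region K'"
      using edge_subset_region cell K e closed_segment_commute by metis+
    have d: "(\<eta> has_derivative (\<lambda>h. grad (region L) \<eta> x \<bullet> h)) (at x within region L)"
      if L: "L \<in> T" "closed_segment a b \<subseteq> region L" for L
      using p[OF L(1)] grad_galerkin(2)[OF cell[OF L(1)] m] x L(2) by blast
    show ?thesis
      using vector_derivative_unique_within_closed_interval[of 0 "1::real" t]
        segment_has_vector_derivative[OF sub(1) t(1) d[OF K(1) sub(1), unfolded t(2)]]
        segment_has_vector_derivative[OF sub(2) t(1) d[OF K(2) sub(2), unfolded t(2)]] t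
      by (simp add: cbox_interval)
  qed
  moreover have "\<exists>A \<in> ref_Hcurl K m. \<forall>x \<in> ref_cell K. \<forall>h.
      grad (region K) \<eta> (cell_map K x) \<bullet> frechet_derivative (cell_map K) (at x) h = A x \<bullet> h"
    if "K \<in> T" for K
    using p[OF that] grad_galerkin(1)[OF cell[OF that] m] by blast
  ultimately show ?thesis unfolding Hcurl_def by blast
qed

section \<open>Boundary terms\<close>

lemma perp_perp [simp]: "perp (perp x) = - x"
  by (simp add: perp_def prod_eq_iff)

lemma perp_minus: "perp (- x) = - perp x"
  by (simp add: perp_def)

lemma perp_scaleR: "perp (c *\<^sub>R x) = c *\<^sub>R perp x"
  by (simp add: perp_def)

text \<open>\<open>perp\<close> turns the outward normal into the counterclockwise unit
  tangent.\<close>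

lemma norm_scaleR_perp_outward_normal: "norm (b - a) *\<^sub>R perp (outward_normal a b) = b - a"
  by (cases "a = b") (simp_all add: outward_normal_def perp_minus perp_scaleR)

lemma boundary_integral_perp_normal:
  "boundary_integral T (\<lambda>K n x. \<Psi> K x * (A K x \<bullet> perp n)) =
    (\<Sum>(K, a, b)\<in>boundary_edges T. integral {0..1}
      (\<lambda>t. \<Psi> K (a + t *\<^sub>R (b - a)) * (A K (a + t *\<^sub>R (b - a)) \<bullet> (b - a))))"
  unfolding boundary_integral_def
proof (rule sum.cong[OF refl], clarify)
  fix K a b
  have "norm (b - a) * (f * (x \<bullet> perp (outward_normal a b))) = f * (x \<bullet> (b - a))" for f x
    using arg_cong[OF norm_scaleR_perp_outward_normal[of b a], of "\<lambda>y. f * (x \<bullet> y)"] by simp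
  then show "norm (b - a) * integral {0..1} (\<lambda>t. \<Psi> K (a + t *\<^sub>R (b - a)) *
        (A K (a + t *\<^sub>R (b - a)) \<bullet> perp (outward_normal a b))) =
      integral {0..1} (\<lambda>t. \<Psi> K (a + t *\<^sub>R (b - a)) * (A K (a + t *\<^sub>R (b - a)) \<bullet> (b - a)))"
    by (subst integral_mult_right[symmetric]) (simp only:)
qed

text \<open>Where \<open>r = 0\<close> the integrand of \<open>g1_integral\<close> is zero because of the division, instead of the
  tangential derivative of \<open>\<Psi>\<close>; on an edge that does not lie on the axis this happens at most once.\<close>

lemma g1_integral_eq:
  assumes axis: "\<forall>(K, a, b) \<in> boundary_edges T. \<not> (fst a = 0 \<and> fst b = 0)"
  shows "g1_integral T \<Psi> \<eta> =
    (\<Sum>(K, a, b)\<in>boundary_edges T. integral {0..1}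
      (\<lambda>t. \<eta> (a + t *\<^sub>R (b - a)) * (grad (region K) (\<Psi> K) (a + t *\<^sub>R (b - a)) \<bullet> (b - a))))"
  unfolding g1_integral_def boundary_integral_def
proof (rule sum.cong[OF refl], clarify)
  fix K a1 a2 b1 b2
  assume "(K, (a1, a2), (b1, b2)) \<in> boundary_edges T"
  define a b where ab: "a = (a1, a2)" "b = (b1, b2)"
  have ax: "\<not> (fst a = 0 \<and> fst b = 0)"
    using axis \<open>(K, (a1, a2), (b1, b2)) \<in> boundary_edges T\<close> unfolding ab by blast
  let ?x = "\<lambda>t. a + t *\<^sub>R (b - a)"
  let ?Z = "{t. fst (?x t) = 0}"
  \<comment> \<open>\<open>fst\<close> is affine along the edge and, by \<open>ax\<close>, not
    identically zero there.\<close>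
  have "s = t" if "s \<in> ?Z" "t \<in> ?Z" for s t
  proof -
    have "fst a + s * (fst b - fst a) = 0" "fst a + t * (fst b - fst a) = 0" using that by auto
    then have "(s - t) * (fst b - fst a) = 0" "fst b - fst a = 0 \<longrightarrow> fst a = 0"
      by (auto simp: algebra_simps)
    then show ?thesis using ax by auto
  qed
  then have "?Z \<subseteq> {t}" if "t \<in> ?Z" for t using that by blast
  then have fin: "finite ?Z" by (metis equals0I finite.emptyI finite_insert finite_subset)
  \<comment> \<open>Away from the axis \<open>r\<close> cancels its reciprocal in \<open>g1\<close>,
    and the minus sign is absorbed when \<open>perp\<close> moves from the gradient to the
    normal.\<close>
  have key: "norm (b - a) * (fst x * \<eta> x * g1 \<Psi> K (outward_normal a b) x)
      = \<eta> x * (grad (region K) (\<Psi> K) x \<bullet> (b - a))" if "fst x \<noteq> 0" for x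
  proof -
    let ?g = "grad (region K) (\<Psi> K) x"
    have "fst x * g1 \<Psi> K (outward_normal a b) x = ?g \<bullet> perp (outward_normal a b)"
      using that perp_inner_swap[of "outward_normal a b" ?g]
      by (simp add: g1_def perp_grad_def inner_commute)
    then have "norm (b - a) * (fst x * \<eta> x * g1 \<Psi> K (outward_normal a b) x)
        = \<eta> x * (?g \<bullet> (norm (b - a) *\<^sub>R perp (outward_normal a b)))"
      by (simp add: mult_ac)
    then show ?thesis by (simp only: norm_scaleR_perp_outward_normal)
  qed
  have "integral {0..1} (\<lambda>t. norm (b - a) * (fst (?x t) * \<eta> (?x t) * g1 \<Psi> K (outward_normal a b) (?x t)))
      = integral {0..1} (\<lambda>t. \<eta> (?x t) * (grad (region K) (\<Psi> K) (?x t) \<bullet> (b - a)))"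
    by (rule integral_spike[OF negligible_finite[OF fin]]) (rule key[symmetric], simp)
  then show "norm ((b1, b2) - (a1, a2)) * integral {0..1} (\<lambda>t.
        fst ((a1, a2) + t *\<^sub>R ((b1, b2) - (a1, a2))) * \<eta> ((a1, a2) + t *\<^sub>R ((b1, b2) - (a1, a2))) *
        g1 \<Psi> K (outward_normal (a1, a2) (b1, b2)) ((a1, a2) + t *\<^sub>R ((b1, b2) - (a1, a2)))) =
      integral {0..1} (\<lambda>t. \<eta> ((a1, a2) + t *\<^sub>R ((b1, b2) - (a1, a2))) *
        (grad (region K) (\<Psi> K) ((a1, a2) + t *\<^sub>R ((b1, b2) - (a1, a2))) \<bullet> ((b1, b2) - (a1, a2))))"
    unfolding ab[symmetric] by (simp only: integral_mult_right)
qed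

text \<open>Regrouping by edges: each boundary edge contributes once at its start and, with opposite
  sign, once at its end.\<close>

lemma sum_boundary_jump:
  assumes T: "is_mesh T"
  shows "(\<Sum>v\<in>(\<Union>K\<in>T. set K). \<eta> v * boundary_jump T \<Psi> v)
    = (\<Sum>(K, a, b)\<in>boundary_edges T. \<eta> a * \<Psi> K a - \<eta> b * \<Psi> K b)"
proof -
  let ?B = "boundary_edges T" and ?V = "\<Union>K\<in>T. set K"
  have fin: "finite ?B" "finite ?V" using finite_boundary_edges[OF T] T by (auto simp: is_mesh_def)
  have "(\<lambda>e. fst (snd e)) ` ?B \<subseteq> ?V" "(\<lambda>e. snd (snd e)) ` ?B \<subseteq> ?V"
    using edges_vertices by (fastforce simp: boundary_edges_def)+
  note groups = sum.group[OF fin this(1), of "\<lambda>(K, a, b). \<eta> a * \<Psi> K a"]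
    sum.group[OF fin this(2), of "\<lambda>(K, a, b). \<eta> b * \<Psi> K b"]
  have "\<eta> v * boundary_jump T \<Psi> v = (\<Sum>(K, a, b)\<in>{e \<in> ?B. fst (snd e) = v}. \<eta> a * \<Psi> K a)
      - (\<Sum>(K, a, b)\<in>{e \<in> ?B. snd (snd e) = v}. \<eta> b * \<Psi> K b)" for v
    unfolding boundary_jump_def right_diff_distrib sum_distrib_left
    by (intro arg_cong2[of _ _ _ _ "(-)"] sum.cong) auto
  then show ?thesis using groups by (simp add: sum_subtractf case_prod_unfold)
qed

text \<open>The end values produced on each edge are the negatives of those collected in the vertex
  masses, so the identity is exact even where \<Psi> jumps.\<close>

lemma boundary_integration_by_parts:
  assumes T: "is_mesh T" and m: "m \<ge> 1" and \<eta>: "\<eta> \<in> CG T m" and \<Psi>: "cellwise_C1 T \<Psi>"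
    and axis: "\<forall>(K, a, b) \<in> boundary_edges T. \<not> (fst a = 0 \<and> fst b = 0)"
  shows "boundary_integral T (\<lambda>K n x. \<Psi> K x * (grad (region K) \<eta> x \<bullet> perp n)) = - g1_pairing T \<Psi> \<eta>"
proof -
  let ?f = "\<lambda>K a b. integral {0..1} (\<lambda>t. \<Psi> K (a + t *\<^sub>R (b - a)) * (grad (region K) \<eta> (a + t *\<^sub>R (b - a)) \<bullet> (b - a)))"
  let ?g = "\<lambda>K a b. integral {0..1} (\<lambda>t. \<eta> (a + t *\<^sub>R (b - a)) * (grad (region K) (\<Psi> K) (a + t *\<^sub>R (b - a)) \<bullet> (b - a)))"
  have "?f K a b + ?g K a b = \<eta> b * \<Psi> K b - \<eta> a * \<Psi> K a" if "(K, a, b) \<in> boundary_edges T" for K a b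
  proof -
    have K: "K \<in> T" "(a, b) \<in> edges K" using that by (auto simp: boundary_edges_def)
    then have cell: "is_cell K" using is_mesh_cell[OF T] by blast
    obtain p where p: "p \<in> ref_CG K m" "\<And>x. x \<in> ref_cell K \<Longrightarrow> \<eta> (cell_map K x) = p x"
      using \<eta> K unfolding CG_def by blast
    obtain D where D: "continuous_on (region K) D"
      "\<And>x. x \<in> region K \<Longrightarrow> (\<Psi> K has_derivative (\<lambda>h. D x \<bullet> h)) (at x within region K)"
      using \<Psi> K unfolding cellwise_C1_def by blast
    have gr: "grad (region K) (\<Psi> K) x = D x" if "x \<in> region K" for x
      using grad_region[OF cell that D(2)[OF that]] .
    show ?thesis
    proof (rule segment_integration_by_parts[OF edge_subset_region[OF cell K(2)]])
      show "continuous_on (region K) (grad (region K) (\<Psi> K))"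
        using D(1) gr by (simp cong: continuous_on_cong)
    qed (use grad_galerkin[OF cell m p] D(2) gr in auto)
  qed
  then have "(\<Sum>(K, a, b)\<in>boundary_edges T. ?f K a b + ?g K a b)
      = (\<Sum>(K, a, b)\<in>boundary_edges T. \<eta> b * \<Psi> K b - \<eta> a * \<Psi> K a)"
    by (intro sum.cong) auto
  also have "\<dots> = - (\<Sum>(K, a, b)\<in>boundary_edges T. \<eta> a * \<Psi> K a - \<eta> b * \<Psi> K b)"
    by (simp add: case_prod_unfold flip: sum_negf)
  finally show ?thesis
    unfolding boundary_integral_perp_normal g1_pairing_def g1_integral_eq[OF axis] sum_boundary_jump[OF T]
    by (simp add: case_prod_unfold sum.distrib)
qed

text \<open>With a single trace the end values depend on the vertex alone, so the masses sum to a
  telescoping boundary sum.\<close>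

lemma g1_pairing_eq_g1_integral:
  assumes T: "is_mesh T" and \<Psi>: "single_trace T \<Psi>"
  shows "g1_pairing T \<Psi> = g1_integral T \<Psi>"
proof
  fix \<eta>
  obtain \<psi> where \<psi>: "\<And>K x. K \<in> T \<Longrightarrow> x \<in> region K \<Longrightarrow> \<Psi> K x = \<psi> x"
    using \<Psi> unfolding single_trace_def by blast
  have "\<Psi> K a = \<psi> a \<and> \<Psi> K b = \<psi> b" if "(K, a, b) \<in> boundary_edges T" for K a b
  proof -
    have K: "K \<in> T" "(a, b) \<in> edges K" using that by (auto simp: boundary_edges_def)
    then have "closed_segment a b \<subseteq> region K" using is_mesh_cell[OF T] edge_subset_region by blast
    then show ?thesis using \<psi>[OF K(1)] ends_in_segment by blast
  qed
  then have "(\<Sum>(K, a, b)\<in>boundary_edges T. \<eta> a * \<Psi> K a - \<eta> b * \<Psi> K b)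
      = (\<Sum>(K, a, b)\<in>boundary_edges T. (- \<eta> b * \<psi> b) - (- \<eta> a * \<psi> a))"
    by (intro sum.cong) auto
  also have "\<dots> = 0" by (rule sum_boundary_edges_eq_0[OF T])
  finally show "g1_pairing T \<Psi> \<eta> = g1_integral T \<Psi> \<eta>"
    by (simp add: g1_pairing_def sum_boundary_jump[OF T])
qed

section \<open>The weak divergence\<close>

text \<open>Take \<open>grad (region K) \<eta>\<close> as test field: it is curl-free, so only the
  boundary term of the equation for \<open>B\<close> remains.\<close>

lemma poloidal_field_flux:
  assumes T: "is_mesh T" and m: "m \<ge> 1" and \<eta>: "\<eta> \<in> CG T m" and \<Psi>: "cellwise_C1 T \<Psi>"
    and axis: "\<forall>(K, a, b) \<in> boundary_edges T. \<not> (fst a = 0 \<and> fst b = 0)"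
    and B: "is_poloidal_field T m \<Psi> B"
  shows "mesh_integral T (\<lambda>K x. (fst x *\<^sub>R grad (region K) \<eta> x) \<bullet> B K x) = - g1_pairing T \<Psi> \<eta>"
proof -
  have "perp_div (region K) (grad (region K) \<eta>) x = 0" if "K \<in> T" "x \<in> region K" for K x
  proof -
    have cell: "is_cell K" by (rule is_mesh_cell[OF T that(1)])
    have "\<exists>p \<in> ref_CG K m. \<forall>x \<in> ref_cell K. \<eta> (cell_map K x) = p x"
      using \<eta> that(1) by (simp add: CG_def)
    then obtain p where p: "p \<in> ref_CG K m" "\<forall>x \<in> ref_cell K. \<eta> (cell_map K x) = p x" ..
    show ?thesis by (rule grad_galerkin(4)[OF cell m p(1) _ that(2)]) (use p(2) in simp)
  qed
  then have "mesh_integral T (\<lambda>K x. perp_div (region K) (grad (region K) \<eta>) x * \<Psi> K x) = 0"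
    unfolding mesh_integral_def by (intro sum.neutral ballI integral_unique has_integral_is_0) simp
  moreover have "mesh_integral T (\<lambda>K x. grad (region K) \<eta> x \<bullet> (fst x *\<^sub>R B K x))
      + mesh_integral T (\<lambda>K x. perp_div (region K) (grad (region K) \<eta>) x * \<Psi> K x)
      - boundary_integral T (\<lambda>K n x. \<Psi> K x * (grad (region K) \<eta> x \<bullet> perp n)) = 0"
    using bspec[OF conjunct2[OF B[unfolded is_poloidal_field_def]] grad_in_Hcurl[OF T m \<eta>]] .
  ultimately show ?thesis
    using boundary_integration_by_parts[OF T m \<eta> \<Psi> axis] by simp
qed

lemma zero_in_CG: "(\<lambda>x. 0) \<in> CG T m"
  by (auto simp: CG_def ref_CG_def intro!: bexI[of _ "\<lambda>x. 0"])

section \<open>Definiteness of the weighted product\<close>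

lemma continuous_on_compact_integrable:
  fixes f :: "'a::euclidean_space \<Rightarrow> real"
  assumes "compact S" "continuous_on S f" shows "f integrable_on S"
proof -
  have "(\<lambda>x. indicator S x *\<^sub>R f x) = (\<lambda>x. if x \<in> S then f x else 0)" by auto
  then show ?thesis
    using integrable_on_lborel[OF borel_integrable_compact[OF assms]]
    by (simp only: integrable_restrict_UNIV)
qed

text \<open>Nonnegativity passes the zero integral to a box around the point, where continuity
  forces the function to vanish.\<close>

lemma integral_eq_0_imp_interior:
  fixes f :: "'a::euclidean_space \<Rightarrow> real"
  assumes S: "compact S" and f: "continuous_on S f" "\<And>x. x \<in> S \<Longrightarrow> f x \<ge> 0"
    and int: "integral S f = 0" and x: "x \<in> interior S"
  shows "f x = 0"
proof -
  obtain a b where ab: "x \<in> box a b" "cbox a b \<subseteq> interior S"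
    using open_contains_cbox[OF open_interior x] by metis
  have sub: "cbox a b \<subseteq> S" using ab interior_subset by blast
  have "integral (cbox a b) f \<le> integral S f"
    by (rule integral_subset_le[OF sub]) (use S f sub in \<open>auto intro: continuous_on_compact_integrable integrable_continuous continuous_on_subset\<close>)
  moreover have "integral (cbox a b) f \<ge> 0"
    by (rule integral_nonneg) (use f sub in \<open>auto intro: integrable_continuous continuous_on_subset\<close>)
  ultimately have "integral (cbox a b) f = 0" using int by simp
  then show ?thesis
    using integral_cbox_eq_0_iff[of a b f] f sub ab(1) box_subset_cbox
    by (metis continuous_on_subset empty_iff subset_iff)
qed

text \<open>The weight \<open>r\<close> may vanish on the axis, but is positive inside every cell;
  density of the interior and continuity of \<open>D\<close> recover the remaining points.\<close>

lemma weak_divergence_zero: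
  assumes T: "is_mesh T" and m: "m \<ge> 1" and r: "\<forall>x \<in> mesh_domain T. fst x \<ge> 0"
    and D: "D \<in> CG T m" and int: "mesh_integral T (\<lambda>K x. D x * (fst x * D x)) = 0"
    and x: "x \<in> mesh_domain T"
  shows "D x = 0"
proof -
  obtain K where K: "K \<in> T" "x \<in> region K" using x by (auto simp: mesh_domain_def)
  have reg: "compact (region L) \<and> region L \<subseteq> closure (interior (region L))" if "L \<in> T" for L
  proof -
    have "is_cell L" by (rule is_mesh_cell[OF T that])
    then obtain a u v w where ref: "reference_map u v w (ref_cell L)" and F: "cell_map L = bilin a u v w"
      using cell_reference_map by metis
    interpret reference_map a u v w "ref_cell L" by (rule ref)
    show ?thesis using compact_image image_subset_closure_interior by (simp add: region_def F)
  qed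
  have sub: "region L \<subseteq> mesh_domain T" if "L \<in> T" for L using that by (auto simp: mesh_domain_def)
  have cont: "continuous_on (region L) D" if "L \<in> T" for L
    using D sub[OF that] continuous_on_subset by (auto simp: CG_def)
  let ?f = "\<lambda>x. D x * (fst x * D x)"
  have contf: "continuous_on (region L) ?f" if "L \<in> T" for L
    by (intro continuous_intros cont that)
  have nonneg: "?f y \<ge> 0" if "L \<in> T" "y \<in> region L" for L y
  proof -
    have "fst y \<ge> 0" using r sub that by blast
    then have "fst y * (D y * D y) \<ge> 0" by simp
    then show ?thesis by (simp add: mult_ac)
  qed
  have "integral (region L) ?f \<ge> 0" if "L \<in> T" for L
    using that reg contf nonneg by (intro integral_nonneg continuous_on_compact_integrable) auto
  then have int0: "integral (region K) ?f = 0"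
    using int K(1) T unfolding mesh_integral_def by (subst (asm) sum_nonneg_eq_0_iff) (auto simp: is_mesh_def)
  have D0: "D y = 0" if y: "y \<in> interior (region K)" for y
  proof -
    have "?f y = 0"
      by (rule integral_eq_0_imp_interior[OF _ contf[OF K(1)] _ int0 y]) (use reg nonneg K in auto)
    moreover have "fst y > 0"
    proof -
      \<comment> \<open>A small step to the left stays in the cell, where \<open>r\<close> is
        nonnegative, so \<open>r\<close> is positive at \<open>y\<close> itself.\<close>
      obtain e where e: "e > 0" "ball y e \<subseteq> region K"
        using y by (meson mem_interior)
      have "y - (e/2, 0) \<in> ball y e" using e(1) by (simp add: dist_norm norm_Pair)
      then have "fst (y - (e/2, 0)) \<ge> 0" using r sub[OF K(1)] e(2) by blast
      then show ?thesis using e(1) by simp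
    qed
    ultimately show ?thesis by simp
  qed
  have "closed {y \<in> region K. D y = 0}"
    using continuous_closed_preimage_constant[OF cont[OF K(1)], of 0] reg[OF K(1)] compact_imp_closed by blast
  moreover have "interior (region K) \<subseteq> {y \<in> region K. D y = 0}"
    using D0 interior_subset by blast
  ultimately have "closure (interior (region K)) \<subseteq> {y \<in> region K. D y = 0}" by (rule closure_minimal[rotated])
  then show ?thesis using reg[OF K(1)] K(2) by blast
qed

theorem proposition4p1:
  fixes T :: "cell set" and m :: nat
    and \<Psi> :: "cell \<Rightarrow> point \<Rightarrow> real" and B :: "cell \<Rightarrow> point \<Rightarrow> point"
  assumes "is_mesh T" and "m \<ge> 1"
    and "\<forall>x \<in> mesh_domain T. fst x \<ge> 0"
    and "\<forall>(K, a, b) \<in> boundary_edges T. \<not> (fst a = 0 \<and> fst b = 0)"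
    and "piecewise_linear (frontier (mesh_domain T))"
    and "cellwise_C1 T \<Psi>"
    and "is_poloidal_field T m \<Psi> B"
  shows "((\<exists>D. is_weak_divergence T m B (g1_pairing T \<Psi>) D) \<and>
          (\<forall>D. is_weak_divergence T m B (g1_pairing T \<Psi>) D \<longrightarrow>
            (\<forall>x \<in> mesh_domain T. D x = 0))) \<and>
         (single_trace T \<Psi> \<longrightarrow>
          (\<exists>D. is_weak_divergence T m B (g1_integral T \<Psi>) D) \<and>
          (\<forall>D. is_weak_divergence T m B (g1_integral T \<Psi>) D \<longrightarrow>
            (\<forall>x \<in> mesh_domain T. D x = 0)))"
proof -
  have rhs: "- mesh_integral T (\<lambda>K x. (fst x *\<^sub>R grad (region K) \<eta> x) \<bullet> B K x) - g1_pairing T \<Psi> \<eta> = 0"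
    if "\<eta> \<in> CG T m" for \<eta>
    using poloidal_field_flux[OF assms(1,2) that assms(6,4,7)] by simp
  \<comment> \<open>The right-hand side vanishes for every test function, so the zero function is a
    weak divergence.\<close>
  have "is_weak_divergence T m B (g1_pairing T \<Psi>) (\<lambda>x. 0)"
    unfolding is_weak_divergence_def using zero_in_CG rhs by (simp add: mesh_integral_def)
  moreover have "D x = 0" if "is_weak_divergence T m B (g1_pairing T \<Psi>) D" "x \<in> mesh_domain T" for D x
  proof -
    have D: "D \<in> CG T m" using that(1) by (simp add: is_weak_divergence_def)
    then have "mesh_integral T (\<lambda>K x. D x * (fst x * D x)) = 0"
      using that(1) rhs[OF D] by (simp add: is_weak_divergence_def)
    from weak_divergence_zero[OF assms(1-3) D this that(2)] show ?thesis .
  qed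
  \<comment> \<open>For a single trace the two boundary functionals coincide, so the second half is
    an instance of the first.\<close>
  ultimately show ?thesis using g1_pairing_eq_g1_integral[OF assms(1)] by metis
qed

end
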